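(* Every integer $N\geq 2$ can be written as $N=a+b$, where $a$ and $b$ are positive integers satisfying $\Omega(ab)\leq 33$.
   Context: For a positive integer $n$, $\Omega(n)$ denotes the number of prime factors of $n$, counted with multiplicity (so $\Omega(1)=0$). *)

theory Defs
  imports "HOL-Computational_Algebra.Primes"
begin

(* prime_factorization n is the multiset of prime factors of n, so its size counts
   them with multiplicity.  Only meaningful for n > 0: the library convention
   prime_factorization 0 = {#} gives the junk value bigomega 0 = 0. *)
definition bigomega :: "nat \<Rightarrow> nat" where
  "bigomega n = size (prime_factorization n)"

end

(*
  For large N put z = N^(1/16). The Chinese remainder theorem fixes a residue class of a modulo
  Q <= sqrt z that keeps both a and N - a free of odd primes up to (log z)/3 and makes
  a (N - a) divisible by 2 at most once; the Brun-Hooley sieve with level about z^12 then removes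
  the remaining primes up to z. Since a (N - a) < z^32, at most 31 odd prime factors survive.

  The sieve estimates require log N to be at least 22400. Below that, no sieve is needed: when
  N < 2^33 take a = 1; otherwise the number of odd prime factors up to sqrt N of a (N - a) is on
  average less than 31, and each of a, N - a has at most one prime factor beyond sqrt N.
  Both regimes use sums of 1/p over a block (w, w^2], bounded by 29/35 + O(1/log w) through
  Mertens' first theorem and the splitting point w^(7/5).
*)
theory Submission
  imports "HOL-Analysis.Analysis" "HOL-Number_Theory.Number_Theory" Defs
    (* Defs comes last: Landau_Symbols also has a constant bigomega. *)
begin

section \<open>Sums over primes\<close>

text \<open>The exponent 16 is a budget in units of t = log z. The block ending at exp(t/2^j) is
  truncated at degree 2j+4, and the sum of (2j+4)/2^j is 12; the one factor of degree 2j+5 in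
  Hooley's argument and the number of blocks cost less than two units more, the crude lower bound
  exp(-t) for the sieve product one, the modulus Q half a unit. The obstacle is the first block.
  With two residues per prime, estimating 1/p over (w, w^2] in one step gives density about 2, and
  2^5/5! * e^2 exceeds 1, so truncation would lose everything. The cut at w^(7/5) lowers the density
  to 58/35 and the loss to 7/10. Small primes are left to the remainder theorem because for them the
  O(1/log w) term swamps the main term. The condition t >= 1400 keeps the density below 17/10 in the
  first two blocks and below 23/10 in the first six. The large range ends with 1 + 31 = 32 prime
  factors; 33 comes from the middle range, as 1 + 30 + 2.\<close>

lemma prod_primes_dvd:
  fixes n :: nat
  assumes "finite S" "\<And>p. p \<in> S \<Longrightarrow> prime p" "\<And>p. p \<in> S \<Longrightarrow> p dvd n"
  shows "\<Prod>S dvd n"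
  using assms
proof (induction S rule: finite_induct)
  case (insert p S)
  have "coprime p (\<Prod>S)"
    using insert by (intro prod_coprime_right) (auto intro!: primes_coprime)
  then show ?case
    using insert by (auto intro!: divides_mult)
qed auto

text \<open>Row 2m+1 of Pascal's triangle has two equal middle entries, together at most the row sum
  2 * 4^m.\<close>

lemma central_binomial_le: "(2 * m + 1) choose m \<le> 4 ^ m"
proof -
  have "2 * ((2 * m + 1) choose m) = ((2*m+1) choose m) + ((2*m+1) choose (m+1))"
    using binomial_symmetric[of m "2*m+1"] by simp
  also have "\<dots> = (\<Sum>k\<in>{m, m+1}. (2*m+1) choose k)" by simp
  also have "\<dots> \<le> (\<Sum>k\<le>2*m+1. (2*m+1) choose k)"
    by (intro sum_mono2) auto
  also have "\<dots> = 2 ^ (2*m+1)" by (rule choose_row_sum)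
  finally show ?thesis by (simp add: power_mult)
qed

text \<open>Erdos' induction: the primes in (m+1, 2m+1] all divide the middle binomial coefficient,
  those up to m+1 fall under the induction hypothesis, and an even n > 2 adds no prime.\<close>

lemma primorial_le: "(\<Prod>p | prime p \<and> p \<le> n. p) \<le> (4::nat) ^ n"
proof (induction n rule: less_induct)
  case (less n)
  consider "n < 2" | "n = 2" | "n > 2" "even n" | m where "n = 2 * m + 1" "m \<ge> 1"
    by (cases "n < 2"; cases "even n") (force elim!: oddE evenE)+
  then show ?case
  proof cases
    case 1
    then have "{p. prime p \<and> p \<le> n} = {}"
      by (auto dest: prime_ge_2_nat)
    then show ?thesis by (simp only:) simp
  next
    case 2
    then have "{p. prime p \<and> p \<le> n} = {2}"
      by (auto dest: prime_ge_2_nat)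
    then show ?thesis using 2 by simp
  next
    case 3
    then have "\<not> prime n" using prime_odd_nat[of n] by auto
    then have "{p. prime p \<and> p \<le> n} = {p. prime p \<and> p \<le> n - 1}"
      using 3 by (auto simp: le_eq_less_or_eq)
    then have "(\<Prod>p | prime p \<and> p \<le> n. p) \<le> 4 ^ (n - 1)"
      using less[of "n - 1"] 3 by simp
    also have "\<dots> \<le> (4::nat) ^ n" by (intro power_increasing) auto
    finally show ?thesis .
  next
    case (4 m)
    let ?B = "{p. prime p \<and> m + 1 < p \<and> p \<le> 2 * m + 1}"
    have fin: "finite ?B" by (rule finite_subset[of _ "{..2*m+1}"]) auto
    have "{p. prime p \<and> p \<le> n} = {p. prime p \<and> p \<le> m + 1} \<union> ?B"
      using 4 by auto
    then have "(\<Prod>p | prime p \<and> p \<le> n. p) = (\<Prod>p | prime p \<and> p \<le> m + 1. p) * \<Prod>?B"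
      using fin by (simp only:) (subst prod.union_disjoint, auto)
    also have "\<dots> \<le> 4 ^ (m + 1) * 4 ^ m"
    proof (rule mult_mono)
      show "(\<Prod>p | prime p \<and> p \<le> m + 1. p) \<le> 4 ^ (m + 1)"
        using less[of "m + 1"] 4 by simp
      have "\<Prod>?B dvd ((2 * m + 1) choose m)"
      proof (rule prod_primes_dvd[OF fin])
        fix p assume p: "p \<in> ?B"
        have "fact m * fact (m + 1) * ((2 * m + 1) choose m) = (fact (2 * m + 1) :: nat)"
          using binomial_fact_lemma[of m "2 * m + 1"] by simp
        moreover have "p dvd fact (2 * m + 1)" "\<not> p dvd fact m" "\<not> p dvd fact (m + 1)"
          using p by (auto simp: prime_dvd_fact_iff simp del: fact_Suc)
        ultimately show "p dvd ((2 * m + 1) choose m)"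
          using p by (metis (no_types, lifting) mem_Collect_eq prime_dvd_mult_iff)
      qed auto
      then have "\<Prod>?B \<le> (2 * m + 1) choose m"
        by (rule dvd_imp_le) simp
      then show "\<Prod>?B \<le> 4 ^ m"
        using central_binomial_le order_trans by blast
    qed auto
    also have "\<dots> = 4 ^ n" using 4 by (simp add: power_add mult_2)
    finally show ?thesis .
  qed
qed

lemma theta_le: "(\<Sum>p | prime p \<and> p \<le> n. ln (real p)) \<le> real n * ln 4"
proof -
  have "(\<Sum>p | prime p \<and> p \<le> n. ln (real p)) = ln (\<Prod>p | prime p \<and> p \<le> n. real p)"
    by (subst ln_prod) (auto simp: prime_gt_0_nat)
  also have "\<dots> = ln (real (\<Prod>p | prime p \<and> p \<le> n. p))" by simp
  also have "\<dots> \<le> ln (real (4 ^ n))"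
    by (subst ln_le_cancel_iff) (auto intro!: prod_pos simp: prime_gt_0_nat primorial_le simp del: of_nat_power of_nat_prod)
  also have "\<dots> = real n * ln 4" by (simp add: ln_realpow)
  finally show ?thesis .
qed

section \<open>Mertens' first theorem with explicit constants\<close>

lemma ln_fact_eq: "ln (fact n) = (\<Sum>d = 1..n. mangoldt d * real (n div d))"
proof -
  have "ln (fact n) = (\<Sum>m=1..n. ln (real m))"
    by (simp add: fact_prod, subst ln_prod) auto
  also have "\<dots> = (\<Sum>m=1..n. \<Sum>d\<in>{d\<in>{1..n}. d dvd m}. mangoldt d)"
  proof (rule sum.cong[OF refl])
    fix m assume m: "m \<in> {1..n}"
    have "{d\<in>{1..n}. d dvd m} = {d. d dvd m}"
      using m by (auto dest: dvd_imp_le intro: Nat.gr0I order_trans)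
    then show "ln (real m) = (\<Sum>d\<in>{d\<in>{1..n}. d dvd m}. mangoldt d)"
      using mangoldt_sum[of m, where ?'a = real] m by simp
  qed
  also have "\<dots> = (\<Sum>d=1..n. \<Sum>m\<in>{m\<in>{1..n}. d dvd m}. mangoldt d)"
    by (rule sum.swap_restrict) auto
  also have "\<dots> = (\<Sum>d = 1..n. mangoldt d * real (n div d))"
  proof (rule sum.cong[OF refl])
    fix d assume d: "d \<in> {1..n}"
    have "{m\<in>{1..n}. d dvd m} = (\<lambda>k. d * k) ` {1..n div d}"
      using d by (auto simp: image_def less_eq_div_iff_mult_less_eq mult.commute elim!: dvdE)
    then have "card {m\<in>{1..n}. d dvd m} = n div d"
      using d by (simp add: card_image inj_on_def)
    then show "(\<Sum>m\<in>{m\<in>{1..n}. d dvd m}. mangoldt d) = mangoldt d * real (n div d)"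
      by simp
  qed
  finally show ?thesis .
qed

text \<open>The shift to n+1 inside the logarithm survives the induction because (n+1) log(1 +
  1/(n+1)) <= 1. Through it a real endpoint w can later be rounded down without loss, since w is at
  most its floor plus 1.\<close>

lemma ln_fact_ge: "ln (fact n) \<ge> real n * ln (real n + 1) - real n"
proof (induction n)
  case (Suc n)
  have "ln (fact (Suc n) :: real) = ln (real n + 1) + ln (fact n)"
    by (simp add: ln_mult add.commute)
  moreover have "(real n + 1) * (ln (real n + 2) - ln (real n + 1)) \<le> 1"
  proof -
    have "ln (real n + 2) - ln (real n + 1) = ln (1 + 1 / (real n + 1))"
      by (subst ln_divide_pos[symmetric]) (auto intro!: arg_cong[of _ _ ln] simp: field_simps)
    also have "\<dots> \<le> 1 / (real n + 1)" by (rule ln_add_one_self_le_self) simp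
    finally show ?thesis by (simp add: field_simps)
  qed
  ultimately show ?case using Suc by (simp add: algebra_simps)
qed simp

lemma ln_fact_le: "ln (fact n) \<le> real n * ln (real n)"
proof (cases "n = 0")
  case False
  have "(fact n :: real) \<le> real n ^ n" using fact_le_power[of n, where 'a = real] by simp
  then have "ln (fact n) \<le> ln (real n ^ n)" using False by (subst ln_le_cancel_iff) auto
  then show ?thesis using False by (simp add: ln_realpow)
qed simp

text \<open>Each prime power is charged to its base, which then carries a geometric series. With
  \<open>f\<close> the logarithm this serves Mertens' lower bound; with \<open>f\<close> = 1 and a
  restriction \<open>A\<close> it bounds a mean number of prime factors.\<close>

lemma sum_primepow_le:
  fixes f :: "nat \<Rightarrow> real"
  assumes "\<And>p. prime p \<Longrightarrow> f p \<ge> 0"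
  shows "(\<Sum>q | primepow q \<and> q \<le> n \<and> A (aprimedivisor q). f (aprimedivisor q) / real q)
     \<le> (\<Sum>p | prime p \<and> p \<le> n \<and> A p. f p / (real p - 1))"
proof -
  let ?Q = "{q. primepow q \<and> q \<le> n \<and> A (aprimedivisor q)}"
  let ?P = "{p. prime p \<and> p \<le> n \<and> A p}"
  have finP: "finite ?P" by (rule finite_subset[of _ "{..n}"]) auto
  \<comment> \<open>Exponents are written \<open>Suc k\<close>: with positive exponents distinct
    pairs give distinct prime powers.\<close>
  have "?Q \<subseteq> (\<lambda>(p, k). p ^ Suc k) ` (?P \<times> {..n})"
  proof
    fix q assume q: "q \<in> ?Q"
    then obtain p k where pk: "prime p" "k > 0" "q = p ^ k" by (auto simp: primepow_def)
    have "aprimedivisor q = p" using pk by (simp add: aprimedivisor_prime_power)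
    have "p \<le> q" using pk by (metis dvd_imp_le dvd_power prime_gt_0_nat zero_less_power)
    have "k \<le> q" using pk power_gt_expt[of p k] by (simp add: prime_gt_Suc_0_nat less_imp_le)
    have "k - 1 \<le> n" using \<open>k \<le> q\<close> q by auto
    then show "q \<in> (\<lambda>(p, k). p ^ Suc k) ` (?P \<times> {..n})"
      using pk q \<open>aprimedivisor q = p\<close> \<open>p \<le> q\<close> \<open>k \<le> q\<close>
      by (intro image_eqI[of _ _ "(p, k - 1)"]) (simp_all add: power_Suc[symmetric] del: power_Suc)
  qed
  then have "(\<Sum>q\<in>?Q. f (aprimedivisor q) / real q)
      \<le> (\<Sum>q\<in>(\<lambda>(p, k). p ^ Suc k) ` (?P \<times> {..n}). f (aprimedivisor q) / real q)"
    using finP assms by (intro sum_mono2) (auto simp: aprimedivisor_prime_power simp del: power_Suc)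
  also have "\<dots> = (\<Sum>(p,k)\<in>?P \<times> {..n}. f p / real p ^ Suc k)"
  proof (subst sum.reindex)
    show "inj_on (\<lambda>(p, k). p ^ Suc k) (?P \<times> {..n})"
      using bij_betw_primepows[where 'a = nat]
      by (auto simp: bij_betw_def intro: inj_on_subset)
    show "sum ((\<lambda>q. f (aprimedivisor q) / real q) \<circ> (\<lambda>(p, k). p ^ Suc k)) (?P \<times> {..n})
      = (\<Sum>(p,k)\<in>?P \<times> {..n}. f p / real p ^ Suc k)"
      by (intro sum.cong) (auto simp: aprimedivisor_prime_power simp del: power_Suc)
  qed
  also have "\<dots> = (\<Sum>p\<in>?P. \<Sum>k\<le>n. f p / real p ^ Suc k)"
    by (simp add: sum.cartesian_product)
  also have "\<dots> \<le> (\<Sum>p\<in>?P. f p / (real p - 1))"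
  proof (rule sum_mono)
    fix p assume p: "p \<in> ?P"
    then have p2: "real p \<ge> 2" by (auto dest: prime_ge_2_nat)
    have "(\<Sum>k\<le>n. 1 / real p ^ Suc k) = (\<Sum>k<Suc n. (1 / real p) ^ k) / real p"
      by (simp add: sum_divide_distrib power_divide lessThan_Suc_atMost mult.commute del: sum.lessThan_Suc)
    also have "\<dots> = (1 - (1 / real p) ^ Suc n) / (1 - 1 / real p) / real p"
      using p2 by (subst sum_gp_strict) auto
    also have "\<dots> \<le> 1 / (1 - 1 / real p) / real p"
      using p2 by (intro divide_right_mono) auto
    also have "\<dots> = 1 / (real p - 1)" using p2 by (simp add: field_simps)
    finally have "f p * (\<Sum>k\<le>n. 1 / real p ^ Suc k) \<le> f p * (1 / (real p - 1))"
      using p assms by (intro mult_left_mono) auto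
    then show "(\<Sum>k\<le>n. f p / real p ^ Suc k) \<le> f p / (real p - 1)"
      by (simp add: sum_distrib_left)
  qed
  finally show ?thesis .
qed

lemma finite_primes_real [simp]: "finite {p::nat. prime p \<and> real p \<le> x \<and> A p}"
  "finite {p::nat. prime p \<and> A p \<and> real p \<le> x}" "finite {p::nat. prime p \<and> real p \<le> x}"
  by (rule finite_subset[of _ "{..nat \<lfloor>x\<rfloor>}"]; force simp: le_nat_floor)+

lemma finite_primes_nat [simp]: "finite {p::nat. prime p \<and> p \<le> n}"
  by (rule finite_subset[of _ "{..n}"]) auto

text \<open>Only the primes are kept in \<open>ln_fact_eq\<close>; lowering n div p to n/p - 1 costs
  theta(n), at most n log 4.\<close>

lemma mertens_upper:
  assumes "n > 0"
  shows "(\<Sum>p | prime p \<and> p \<le> n. ln (real p) / real p) \<le> ln (real n) + ln 4"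
proof -
  let ?P = "{p. prime p \<and> p \<le> n}"
  have "real n * (\<Sum>p\<in>?P. ln (real p) / real p) - (\<Sum>p\<in>?P. ln (real p))
      = (\<Sum>p\<in>?P. ln (real p) * (real n / real p - 1))"
    by (simp add: sum_distrib_left sum_subtractf algebra_simps)
  also have "\<dots> \<le> (\<Sum>p\<in>?P. mangoldt p * real (n div p))"
  proof (rule sum_mono)
    fix p assume p: "p \<in> ?P"
    then have "p > 0" by (simp add: prime_gt_0_nat)
    have "real n / real p - 1 \<le> real (n div p)"
      using \<open>p > 0\<close> floor_divide_of_nat_eq[of n p, where 'a = real] by linarith
    then show "ln (real p) * (real n / real p - 1) \<le> mangoldt p * real (n div p)"
      using p \<open>p > 0\<close> by (auto intro!: mult_left_mono)
  qed
  also have "\<dots> \<le> (\<Sum>d = 1..n. mangoldt d * real (n div d))"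
    by (intro sum_mono2) (auto simp: mangoldt_nonneg prime_ge_1_nat prime_ge_Suc_0_nat)
  also have "\<dots> = ln (fact n)" by (simp add: ln_fact_eq)
  also have "\<dots> \<le> real n * ln (real n)" by (rule ln_fact_le)
  finally have "real n * (\<Sum>p\<in>?P. ln (real p) / real p) \<le> real n * (ln (real n) + ln 4)"
    using theta_le[of n] by (simp add: algebra_simps)
  then show ?thesis using assms by simp
qed

lemma mertens_lower_aux: "ln (real n + 1) - 1 \<le> (\<Sum>p | prime p \<and> p \<le> n. ln (real p) / (real p - 1))"
proof (cases "n = 0")
  case False
  let ?Q = "{q. primepow q \<and> q \<le> n \<and> True}"
  have "real n * (ln (real n + 1) - 1) \<le> ln (fact n)"
    using ln_fact_ge[of n] by (simp add: algebra_simps)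
  also have "\<dots> = (\<Sum>d\<in>?Q. mangoldt d * real (n div d))"
    unfolding ln_fact_eq
    by (rule sum.mono_neutral_right) (auto simp: mangoldt_def primepow_gt_0_nat Suc_le_eq)
  also have "\<dots> \<le> (\<Sum>q\<in>?Q. real n * (ln (real (aprimedivisor q)) / real q))"
  proof (rule sum_mono)
    fix q assume q: "q \<in> ?Q"
    have "mangoldt q * real (n div q) \<le> mangoldt q * (real n / real q)"
      by (intro mult_left_mono of_nat_div_le_of_nat mangoldt_nonneg)
    then show "mangoldt q * real (n div q) \<le> real n * (ln (real (aprimedivisor q)) / real q)"
      using q by (simp add: mangoldt_def mult.commute)
  qed
  also have "\<dots> = real n * (\<Sum>q\<in>?Q. ln (real (aprimedivisor q)) / real q)"
    by (simp add: sum_distrib_left)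
  also have "\<dots> \<le> real n * (\<Sum>p | prime p \<and> p \<le> n \<and> True. ln (real p) / (real p - 1))"
    proof (intro mult_left_mono sum_primepow_le)
    show "0 \<le> ln (real p)" if "prime p" for p
      using prime_ge_1_nat[OF that] by simp
  qed simp
  finally show ?thesis using False by simp
qed simp

text \<open>Telescoping: -(log x + 1)/x is an antiderivative of log x / x^2, and shifting the
  logarithm to n+1 makes each increment dominate the next term. Both sides vanish at n = 1.\<close>

lemma sum_ln_over_consecutive:
  "n \<ge> 1 \<Longrightarrow> (\<Sum>k=2..n. ln (real k) / (real k * (real k - 1)))
     \<le> 1 + ln 2 - (ln (real n + 1) + 1) / real n"
proof (induction n rule: nat_induct_at_least)
  case (Suc n)
  have n: "real n \<ge> 1" using Suc by simp
  have eq: "(ln (real n + 1) + 1) / real n - (ln (real n + 2) + 1) / (real n + 1)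
     = (ln (real n + 1) + (1 - real n * (ln (real n + 2) - ln (real n + 1)))) / ((real n + 1) * real n)"
    using n by (simp add: divide_simps) (simp add: algebra_simps)
  have "ln (real n + 2) - ln (real n + 1) = ln (1 + 1 / (real n + 1))"
    by (subst ln_divide_pos[symmetric]) (auto intro!: arg_cong[of _ _ ln] simp: field_simps)
  also have "\<dots> \<le> 1 / (real n + 1)" by (rule ln_add_one_self_le_self) simp
  finally have "real n * (ln (real n + 2) - ln (real n + 1)) \<le> real n * (1 / (real n + 1))"
    by (rule mult_left_mono) simp
  also have "\<dots> \<le> 1" using n by (simp add: field_simps)
  finally have "ln (real n + 1) / ((real n + 1) * real n)
     \<le> (ln (real n + 1) + 1) / real n - (ln (real n + 2) + 1) / (real n + 1)"
    unfolding eq using n by (intro divide_right_mono) auto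
  moreover have "(\<Sum>k=2..Suc n. ln (real k) / (real k * (real k - 1)))
      = (\<Sum>k=2..n. ln (real k) / (real k * (real k - 1))) + ln (real n + 1) / ((real n + 1) * real n)"
    using Suc by (simp add: add.commute)
  ultimately show ?case using Suc by (simp add: add.commute)
qed simp

text \<open>Split 1/(p-1) = 1/p + 1/(p(p-1)) and extend the second part to all integers; it costs 1
  + ln 2.\<close>

lemma mertens_lower:
  "ln (real n + 1) - 2 - ln 2 \<le> (\<Sum>p | prime p \<and> p \<le> n. ln (real p) / real p)"
proof -
  let ?P = "{p. prime p \<and> p \<le> n}"
  have "(\<Sum>p\<in>?P. ln (real p) / (real p - 1)) =
      (\<Sum>p\<in>?P. ln (real p) / real p + ln (real p) / (real p * (real p - 1)))"
    by (intro sum.cong) (auto dest!: prime_gt_1_nat simp: divide_simps algebra_simps)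
  also have "\<dots> = (\<Sum>p\<in>?P. ln (real p) / real p) + (\<Sum>p\<in>?P. ln (real p) / (real p * (real p - 1)))"
    by (rule sum.distrib)
  also have "(\<Sum>p\<in>?P. ln (real p) / (real p * (real p - 1)))
      \<le> (\<Sum>k=2..n. ln (real k) / (real k * (real k - 1)))"
    by (rule sum_mono2) (auto dest: prime_ge_2_nat)
  also have "\<dots> \<le> 1 + ln 2"
  proof (cases "n \<ge> 1")
    case True
    then show ?thesis using sum_ln_over_consecutive[OF True] by (smt (verit) divide_nonneg_nonneg ln_ge_zero of_nat_0_le_iff)
  qed simp
  finally show ?thesis using mertens_lower_aux[of n] by simp
qed

section \<open>Sums of 1/p over blocks of primes\<close>

text \<open>The errors of the two Mertens bounds add up to ln 4 + 2 + ln 2 = 2 + 3 ln 2, and ln 2 <=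
  25/36 puts this below 41/10.\<close>

lemma sum_ln_prime_block:
  assumes "1 \<le> w" "w \<le> v"
  shows "(\<Sum>p | prime p \<and> w < real p \<and> real p \<le> v. ln (real p) / real p) \<le> ln v - ln w + 41/10"
proof -
  let ?m = "nat \<lfloor>w\<rfloor>" and ?n = "nat \<lfloor>v\<rfloor>"
  have mn: "?m \<le> ?n" "?n > 0" using assms by (auto intro!: nat_mono floor_mono)
  have "real ?n \<le> v" "w \<le> real ?m + 1" using assms by linarith+
  have eq: "{p. prime p \<and> p \<le> ?n} = {p. prime p \<and> p \<le> ?m} \<union> {p. prime p \<and> w < real p \<and> real p \<le> v}"
    using assms mn by (auto simp: le_nat_floor le_nat_iff le_floor_iff not_le)
  have "(\<Sum>p | prime p \<and> p \<le> ?n. ln (real p) / real p) = (\<Sum>p | prime p \<and> p \<le> ?m. ln (real p) / real p)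
      + (\<Sum>p | prime p \<and> w < real p \<and> real p \<le> v. ln (real p) / real p)"
    unfolding eq using assms by (intro sum.union_disjoint) (auto simp: le_nat_iff le_floor_iff)
  moreover have "ln (real ?n) \<le> ln v" using \<open>real ?n \<le> v\<close> mn by (subst ln_le_cancel_iff) auto
  moreover have "ln w \<le> ln (real ?m + 1)" using \<open>w \<le> real ?m + 1\<close> assms by (subst ln_le_cancel_iff) linarith+
  moreover have "ln (4::real) = 2 * ln 2" using ln_realpow[of 2 2] by simp
  ultimately show ?thesis using mertens_upper[OF mn(2)] mertens_lower[of ?m] ln2_le_25_over_36 by linarith
qed

text \<open>The factor log p / log w >= 1 stands in for partial summation. It is wasteful when log v
  is much larger than log w, hence the subdivision in the next lemma.\<close>

lemma sum_inverse_prime_block: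
  assumes "1 < w" "w \<le> v"
  shows "(\<Sum>p | prime p \<and> w < real p \<and> real p \<le> v. 1 / real p) \<le> (ln v - ln w + 41/10) / ln w"
proof -
  have "(\<Sum>p | prime p \<and> w < real p \<and> real p \<le> v. 1 / real p)
     \<le> (\<Sum>p | prime p \<and> w < real p \<and> real p \<le> v. (ln (real p) / real p) / ln w)"
  proof (rule sum_mono)
    fix p assume "p \<in> {p. prime p \<and> w < real p \<and> real p \<le> v}"
    then have p: "w < real p" by simp
    then have "ln w \<le> ln (real p)" "ln w > 0" using assms by auto
    then show "1 / real p \<le> (ln (real p) / real p) / ln w"
      using p assms by (simp add: divide_simps)
  qed
  also have "\<dots> = (\<Sum>p | prime p \<and> w < real p \<and> real p \<le> v. ln (real p) / real p) / ln w"
    by (simp add: sum_divide_distrib)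
  also have "\<dots> \<le> (ln v - ln w + 41/10) / ln w"
    using assms by (intro divide_right_mono sum_ln_prime_block) auto
  finally show ?thesis .
qed

lemma sum_inverse_prime_square_block:
  assumes "1 < w" "v \<le> w\<^sup>2"
  shows "(\<Sum>p | prime p \<and> w < real p \<and> real p \<le> v. 1 / real p) \<le> 29/35 + 246/35 / ln w"
proof -
  \<comment> \<open>A cut at w^x gives the main term (x - 1) + (2/x - 1), least at x = sqrt 2. With
    7/5 it is 2/5 + 3/7 = 29/35; one piece would give 1, arbitrarily fine cuts ln 2.\<close>
  define u where "u = w powr (7/5)"
  have lnu: "ln u = 7/5 * ln w" using assms by (simp add: u_def ln_powr)
  have "w powr 1 \<le> u" "u \<le> w powr 2"
    unfolding u_def using assms by (intro powr_mono; simp)+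
  then have u: "w \<le> u" "u \<le> w\<^sup>2" using assms by (auto simp: powr_numeral)
  have lw: "ln w > 0" using assms by simp
  have "(\<Sum>p | prime p \<and> w < real p \<and> real p \<le> v. 1 / real p)
      \<le> (\<Sum>p\<in>{p. prime p \<and> w < real p \<and> real p \<le> u} \<union> {p. prime p \<and> u < real p \<and> real p \<le> w\<^sup>2}. 1 / real p)"
    using assms by (intro sum_mono2) auto
  also have "\<dots> = (\<Sum>p | prime p \<and> w < real p \<and> real p \<le> u. 1 / real p)
      + (\<Sum>p | prime p \<and> u < real p \<and> real p \<le> w\<^sup>2. 1 / real p)"
    by (intro sum.union_disjoint) auto
  also have "\<dots> \<le> (ln u - ln w + 41/10) / ln w + (ln (w\<^sup>2) - ln u + 41/10) / ln u"
    using u assms by (intro add_mono sum_inverse_prime_block) auto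
  also have "\<dots> = 29/35 + 246/35 / ln w"
    using lw assms by (simp add: lnu ln_realpow divide_simps)
  finally show ?thesis .
qed

section \<open>The Brun-Hooley sieve\<close>

definition elem_sym :: "nat \<Rightarrow> 'a set \<Rightarrow> ('a \<Rightarrow> real) \<Rightarrow> real" where
  "elem_sym m P g = (\<Sum>D | D \<subseteq> P \<and> card D = m. \<Prod>p\<in>D. g p)"

text \<open>Inclusion-exclusion for the product of 1 - g p, truncated at degree b. Real weights let
  it serve both for 0/1 indicators of residues and for their densities.\<close>

definition bonferroni :: "nat \<Rightarrow> 'a set \<Rightarrow> ('a \<Rightarrow> real) \<Rightarrow> real" where
  "bonferroni b P g = (\<Sum>D | D \<subseteq> P \<and> card D \<le> b. (-1) ^ card D * (\<Prod>p\<in>D. g p))"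

text \<open>The predicate \<open>Q\<close> covers both "size equal to m" and "size at most b", so
  \<open>elem_sym\<close> and \<open>bonferroni\<close> get their recursions from one split by
  membership of p.\<close>

lemma sum_subsets_insert:
  assumes "finite P" "p \<notin> P"
  shows "(\<Sum>D | D \<subseteq> insert p P \<and> Q (card D). F D)
    = (\<Sum>D | D \<subseteq> P \<and> Q (card D). F D) + (\<Sum>D | D \<subseteq> P \<and> Q (Suc (card D)). F (insert p D))"
proof -
  let ?A = "{D. D \<subseteq> P \<and> Q (card D)}" and ?B = "{D. D \<subseteq> P \<and> Q (Suc (card D))}"
  have card: "card (insert p D) = Suc (card D)" if "D \<subseteq> P" for D
    using that assms by (subst card_insert_disjoint) (auto intro: finite_subset)
  have eq: "{D. D \<subseteq> insert p P \<and> Q (card D)} = ?A \<union> insert p ` ?B"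
  proof (intro equalityI subsetI)
    fix D assume D: "D \<in> {D. D \<subseteq> insert p P \<and> Q (card D)}"
    show "D \<in> ?A \<union> insert p ` ?B"
    proof (cases "p \<in> D")
      case True
      then have "D = insert p (D - {p})" "D - {p} \<subseteq> P" using D by auto
      
      then have "D - {p} \<in> ?B" using D card[of "D - {p}"] by simp
      then show ?thesis using \<open>D = insert p (D - {p})\<close> by blast
    qed (use D in auto)
  next
    fix D assume "D \<in> ?A \<union> insert p ` ?B"
    then consider "D \<in> ?A" | E where "E \<in> ?B" "D = insert p E" by blast
    then show "D \<in> {D. D \<subseteq> insert p P \<and> Q (card D)}"
    proof cases
      case 2
      then show ?thesis using card[of E] by simp blast
    qed auto
  qed
  have "finite ?A" "finite ?B" using assms by auto
  moreover have "?A \<inter> insert p ` ?B = {}" using assms by auto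
  moreover have "inj_on (insert p) ?B"
    using assms by (intro inj_onI) (metis (no_types, lifting) insert_ident mem_Collect_eq subset_iff)
  ultimately show ?thesis
    unfolding eq by (subst sum.union_disjoint) (auto simp: sum.reindex)
qed

lemma prod_insert_subset:
  "finite P \<Longrightarrow> p \<notin> P \<Longrightarrow> D \<subseteq> P \<Longrightarrow> (\<Prod>q\<in>insert p D. g q) = g p * (\<Prod>q\<in>D. (g q :: real))"
  by (rule prod.insert) (auto intro: finite_subset)

lemma elem_sym_0 [simp]: "finite P \<Longrightarrow> elem_sym 0 P g = 1"
proof -
  assume "finite P"
  then have "{D. D \<subseteq> P \<and> card D = 0} = {{}}" by (auto dest: finite_subset)
  then show ?thesis unfolding elem_sym_def by (simp only:) simp
qed

lemma bonferroni_0 [simp]: "finite P \<Longrightarrow> bonferroni 0 P g = 1"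
proof -
  assume "finite P"
  then have "{D. D \<subseteq> P \<and> card D \<le> 0} = {{}}" by (auto dest: finite_subset)
  then show ?thesis unfolding bonferroni_def by (simp only:) simp
qed

lemma elem_sym_insert:
  assumes "finite P" "p \<notin> P"
  shows "elem_sym (Suc m) (insert p P) g = elem_sym (Suc m) P g + g p * elem_sym m P g"
proof -
  have "(\<Sum>D | D \<subseteq> P \<and> Suc (card D) = Suc m. \<Prod>q\<in>insert p D. g q)
     = (\<Sum>D | D \<subseteq> P \<and> card D = m. g p * (\<Prod>q\<in>D. g q))"
    by (intro sum.cong) (auto simp: prod_insert_subset[OF assms])
  then show ?thesis unfolding elem_sym_def
    by (subst sum_subsets_insert[OF assms]) (simp add: sum_distrib_left)
qed

lemma bonferroni_insert:
  assumes "finite P" "p \<notin> P"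
  shows "bonferroni (Suc b) (insert p P) g = bonferroni (Suc b) P g - g p * bonferroni b P g"
proof -
  have "(\<Sum>D | D \<subseteq> P \<and> Suc (card D) \<le> Suc b. (-1) ^ card (insert p D) * (\<Prod>q\<in>insert p D. g q))
     = (\<Sum>D | D \<subseteq> P \<and> card D \<le> b. - (g p * ((-1) ^ card D * (\<Prod>q\<in>D. g q))))"
  proof (intro sum.cong)
    fix D assume "D \<in> {D. D \<subseteq> P \<and> card D \<le> b}"
    then have "card (insert p D) = Suc (card D)" "D \<subseteq> P"
      using assms by (auto intro!: card_insert_disjoint intro: finite_subset)
    then show "(-1) ^ card (insert p D) * (\<Prod>q\<in>insert p D. g q) = - (g p * ((-1) ^ card D * (\<Prod>q\<in>D. g q)))"
      by (simp add: prod_insert_subset[OF assms])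
  qed auto
  then show ?thesis unfolding bonferroni_def
    by (subst sum_subsets_insert[OF assms]) (simp add: sum_distrib_left sum_negf)
qed

lemma elem_sym_nonneg: "(\<And>p. p \<in> P \<Longrightarrow> 0 \<le> g p) \<Longrightarrow> elem_sym m P g \<ge> 0"
  unfolding elem_sym_def by (intro sum_nonneg prod_nonneg) auto

text \<open>Expanding the m-th power of the sum produces every product of m distinct terms m!
  times.\<close>

lemma elem_sym_le:
  assumes "finite P" "\<And>p. p \<in> P \<Longrightarrow> 0 \<le> g p"
  shows "elem_sym m P g \<le> (\<Sum>p\<in>P. g p) ^ m / fact m"
  using assms
proof (induction P arbitrary: m rule: finite_induct)
  case empty
  then show ?case
    by (cases m) (simp, simp add: elem_sym_def)
next
  case (insert p P)
  let ?G = "\<Sum>p\<in>P. g p"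
  have nn: "?G \<ge> 0" "g p \<ge> 0" using insert by (auto intro: sum_nonneg)
  show ?case
  proof (cases m)
    case (Suc n)
    have IH: "elem_sym m P g \<le> ?G ^ m / fact m" for m using insert by auto
    have "elem_sym m (insert p P) g \<le> ?G ^ Suc n / fact (Suc n) + g p * (?G ^ n / fact n)"
      unfolding Suc elem_sym_insert[OF insert(1,2)]
      by (intro add_mono mult_left_mono IH nn)
    also have "g p * (?G ^ n / fact n) = real (Suc n) * g p * ?G ^ n / fact (Suc n)"
      unfolding fact_Suc of_nat_mult by (simp add: divide_simps del: of_nat_Suc)
    also have "?G ^ Suc n / fact (Suc n) + \<dots> = (?G ^ Suc n + real (Suc n) * g p * ?G ^ n) / fact (Suc n)"
      by (rule add_divide_distrib[symmetric])
    also have "\<dots> \<le> (g p + ?G) ^ Suc n / fact (Suc n)"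
    proof (rule divide_right_mono)
      \<comment> \<open>The left side is the first two terms of the binomial expansion of the right
        side.\<close>
      show "?G ^ Suc n + real (Suc n) * g p * ?G ^ n \<le> (g p + ?G) ^ Suc n"
      proof (induction n)
        case (Suc n)
        have "?G ^ Suc (Suc n) + real (Suc (Suc n)) * g p * ?G ^ Suc n
           \<le> (g p + ?G) * (?G ^ Suc n + real (Suc n) * g p * ?G ^ n)"
          using nn by (simp add: algebra_simps)
        also have "\<dots> \<le> (g p + ?G) * (g p + ?G) ^ Suc n"
          using Suc nn by (intro mult_left_mono) auto
        finally show ?case by simp
      qed simp
    qed simp
    finally show ?thesis using insert Suc by simp
  qed (use insert in simp)
qed

text \<open>By \<open>bonferroni_insert\<close>, a new element subtracts a multiple of the
  truncation one degree lower, whose inequality points the other way; so both parities are proved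
  together.\<close>

lemma bonferroni_bounds:
  assumes "finite P" "\<And>p. p \<in> P \<Longrightarrow> 0 \<le> g p \<and> g p \<le> 1"
  shows "(even b \<longrightarrow> (\<Prod>p\<in>P. 1 - g p) \<le> bonferroni b P g) \<and>
         (odd b \<longrightarrow> bonferroni b P g \<le> (\<Prod>p\<in>P. 1 - g p))"
  using assms
proof (induction P arbitrary: b rule: finite_induct)
  case empty
  have "bonferroni b {} g = 1"
    unfolding bonferroni_def by (simp add: conj_commute cong: conj_cong)
  then show ?case by simp
next
  case (insert p P)
  show ?case
  proof (cases b)
    case 0
    then show ?thesis using insert by (simp del: prod.insert) (intro prod_le_1, auto)
  next
    case (Suc n)
    let ?V = "\<Prod>p\<in>P. 1 - g p"
    have gp: "g p \<ge> 0" using insert by auto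
    have V: "(\<Prod>p\<in>insert p P. 1 - g p) = ?V - g p * ?V" using insert by (simp add: algebra_simps)
    have *: "bonferroni b (insert p P) g = bonferroni (Suc n) P g - g p * bonferroni n P g"
      unfolding Suc using insert by (intro bonferroni_insert)
    have IH: "(even b \<longrightarrow> ?V \<le> bonferroni b P g) \<and> (odd b \<longrightarrow> bonferroni b P g \<le> ?V)" for b
      using insert by auto
    show ?thesis
      unfolding V * using IH[of "Suc n"] IH[of n] gp
      by (auto simp: Suc intro!: diff_mono mult_left_mono)
  qed
qed

lemma bonferroni_Suc:
  assumes "finite P"
  shows "bonferroni (Suc b) P g = bonferroni b P g + (-1) ^ Suc b * elem_sym (Suc b) P g"
proof -
  have "{D. D \<subseteq> P \<and> card D \<le> Suc b} = {D. D \<subseteq> P \<and> card D \<le> b} \<union> {D. D \<subseteq> P \<and> card D = Suc b}"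
    by auto
  then show ?thesis
    unfolding bonferroni_def elem_sym_def using assms
    by (simp only:) (subst sum.union_disjoint, auto simp: sum_distrib_left)
qed

text \<open>The truncation at the odd degree b+1 is already below the product, and it differs from
  the one at b by a single elementary symmetric sum.\<close>

lemma bonferroni_le:
  assumes "finite P" "\<And>p. p \<in> P \<Longrightarrow> 0 \<le> g p \<and> g p \<le> 1" "even b"
  shows "bonferroni b P g \<le> (\<Prod>p\<in>P. 1 - g p) + elem_sym (Suc b) P g"
  using bonferroni_bounds[of P g "Suc b"] bonferroni_Suc[of P b g] assms by simp

section \<open>Equidistribution in residue classes\<close>

lemma card_residue_class:
  fixes d c X :: nat
  assumes "c < d"
  shows "\<bar>real (card {k. k < X \<and> k mod d = c}) - real X / real d\<bar> \<le> 1"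
proof -
  have d: "d > 0" using assms by simp
  define A where "A = {i. d * i + c < X}"
  have "{k. k < X \<and> k mod d = c} = (\<lambda>i. d * i + c) ` A"
  proof (intro equalityI subsetI)
    fix k assume "k \<in> {k. k < X \<and> k mod d = c}"
    then show "k \<in> (\<lambda>i. d * i + c) ` A"
      unfolding A_def by (auto intro!: image_eqI[of _ _ "k div d"])
  qed (use assms in \<open>auto simp: A_def\<close>)
  moreover have "inj_on (\<lambda>i. d * i + c) A" using d by (auto simp: inj_on_def)
  ultimately have card: "card {k. k < X \<and> k mod d = c} = card A" by (simp add: card_image)
  have sub: "A \<subseteq> {..X div d}"
  proof
    fix i assume "i \<in> A"
    then have "i * d \<le> X" unfolding A_def by (simp add: mult.commute)
    then show "i \<in> {..X div d}" using d by (simp add: less_eq_div_iff_mult_less_eq)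
  qed
  have "{..<X div d} \<subseteq> A"
  proof
    fix i assume "i \<in> {..<X div d}"
    then have "Suc i \<le> X div d" by simp
    then have "Suc i * d \<le> X" using d by (simp add: less_eq_div_iff_mult_less_eq)
    then show "i \<in> A" using assms unfolding A_def by (simp add: mult.commute)
  qed
  then have "X div d \<le> card A"
    using card_mono[OF finite_subset[OF sub], of "{..<X div d}"] by simp
  moreover have "card A \<le> X div d + 1"
    using card_mono[OF _ sub] by simp
  moreover have "real (X div d) \<le> real X / real d" "real X / real d \<le> real (X div d) + 1"
    using d floor_divide_of_nat_eq[of X d, where 'a = real] by linarith+
  ultimately show ?thesis unfolding card by linarith
qed

lemma card_simultaneous_residues:
  fixes f :: "nat \<Rightarrow> nat"
  assumes "finite S" "\<And>p. p \<in> S \<Longrightarrow> prime p" "\<And>p. p \<in> S \<Longrightarrow> f p < p"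
  shows "\<bar>real (card {k. k < X \<and> (\<forall>p\<in>S. k mod p = f p)}) - real X / (\<Prod>p\<in>S. real p)\<bar> \<le> 1"
proof -
  have pos: "\<forall>i\<in>S. i \<noteq> 0" using assms by (auto dest: prime_gt_0_nat)
  have "\<forall>i\<in>S. \<forall>j\<in>S. i \<noteq> j \<longrightarrow> coprime i j" using assms by (auto intro: primes_coprime)
  from chinese_remainder_unique_nat[OF assms(1) pos this, of f]
  obtain c where c: "c < \<Prod>S" "\<forall>i\<in>S. [c = f i] (mod i)" by auto
  have "k mod \<Prod>S = c \<longleftrightarrow> (\<forall>p\<in>S. k mod p = f p)" for k
  proof -
    have "k mod \<Prod>S = c \<longleftrightarrow> [k = c] (mod \<Prod>S)" using c by (simp add: cong_def)
    also have "\<dots> \<longleftrightarrow> (\<forall>p\<in>S. [k = c] (mod p))"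
      using assms(1,2)
      by (auto intro!: coprime_cong_prod_nat primes_coprime intro: cong_dvd_modulus_nat)
    also have "\<dots> \<longleftrightarrow> (\<forall>p\<in>S. k mod p = f p)"
      using c assms by (auto simp: cong_def)
    finally show ?thesis .
  qed
  then show ?thesis using card_residue_class[OF c(1), of X] by simp
qed

definition in_residues :: "(nat \<Rightarrow> nat set) \<Rightarrow> nat \<Rightarrow> nat \<Rightarrow> real" where
  "in_residues R k p = (if k mod p \<in> R p then 1 else 0)"

text \<open>The product of indicators is a sum over choice functions picking one residue from each
  \<open>R p\<close>. By the remainder theorem each choice is a single class with counting error at
  most 1, so the total error is at most the number of choices.\<close>

lemma sieve_level:
  assumes "finite S" "\<And>p. p \<in> S \<Longrightarrow> prime p" "\<And>p. p \<in> S \<Longrightarrow> R p \<subseteq> {..<p}"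
  shows "\<bar>(\<Sum>k<X. \<Prod>p\<in>S. in_residues R k p) - real X * (\<Prod>p\<in>S. real (card (R p)) / real p)\<bar>
     \<le> (\<Prod>p\<in>S. real (card (R p)))"
proof -
  have finR: "finite (R p)" if "p \<in> S" for p using assms(3)[OF that] by (rule finite_subset) simp
  let ?F = "PiE S R"
  have finF: "finite ?F" using assms(1) finR by (intro finite_PiE)
  have cardF: "real (card ?F) = (\<Prod>p\<in>S. real (card (R p)))"
    using assms(1) by (simp add: card_PiE)
  have "(\<Prod>p\<in>S. in_residues R k p) = (\<Sum>f\<in>?F. if \<forall>p\<in>S. k mod p = f p then 1 else 0)" for k
  proof -
    have "(\<Prod>p\<in>S. in_residues R k p) = (\<Prod>p\<in>S. \<Sum>r\<in>R p. if k mod p = r then 1 else 0)"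
      using finR by (intro prod.cong) (auto simp: in_residues_def)
    also have "\<dots> = (\<Sum>f\<in>?F. \<Prod>p\<in>S. if k mod p = f p then 1 else 0)"
      by (rule prod_sum_PiE) (use assms finR in auto)
    also have "\<dots> = (\<Sum>f\<in>?F. if \<forall>p\<in>S. k mod p = f p then 1 else 0)"
      using assms(1) by (intro sum.cong) (auto simp: prod_zero_iff)
    finally show ?thesis .
  qed
  then have "(\<Sum>k<X. \<Prod>p\<in>S. in_residues R k p)
     = (\<Sum>f\<in>?F. \<Sum>k<X. if \<forall>p\<in>S. k mod p = f p then 1 else 0)"
    by (simp add: sum.swap[of _ ?F])
  also have "\<dots> = (\<Sum>f\<in>?F. real (card {k. k < X \<and> (\<forall>p\<in>S. k mod p = f p)}))"
  proof (intro sum.cong refl)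
    fix f
    have "(\<Sum>k<X. if \<forall>p\<in>S. k mod p = f p then 1 else 0) = (\<Sum>k\<in>{k\<in>{..<X}. \<forall>p\<in>S. k mod p = f p}. 1::real)"
      by (rule sum.inter_filter[symmetric]) simp
    then show "(\<Sum>k<X. if \<forall>p\<in>S. k mod p = f p then 1 else 0) = real (card {k. k < X \<and> (\<forall>p\<in>S. k mod p = f p)})"
      by simp
  qed
  finally have "(\<Sum>k<X. \<Prod>p\<in>S. in_residues R k p)
     = (\<Sum>f\<in>?F. real (card {k. k < X \<and> (\<forall>p\<in>S. k mod p = f p)}))" .
  moreover have "real X * (\<Prod>p\<in>S. real (card (R p)) / real p) = (\<Sum>f\<in>?F. real X / (\<Prod>p\<in>S. real p))"
    by (simp add: cardF prod_dividef)
  ultimately have "\<bar>(\<Sum>k<X. \<Prod>p\<in>S. in_residues R k p) - real X * (\<Prod>p\<in>S. real (card (R p)) / real p)\<bar>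
     = \<bar>\<Sum>f\<in>?F. real (card {k. k < X \<and> (\<forall>p\<in>S. k mod p = f p)}) - real X / (\<Prod>p\<in>S. real p)\<bar>"
    by (simp add: sum_subtractf)
  also have "\<dots> \<le> (\<Sum>f\<in>?F. 1)"
    using assms by (intro order_trans[OF sum_abs] sum_mono card_simultaneous_residues) (auto simp: PiE_iff)
  finally show ?thesis by (simp add: cardF)
qed

text \<open>Multiplying out picks one D per block, and disjointness of the blocks turns the picks
  into one set of primes for \<open>sieve_level\<close>. The error factors over the blocks again.
  The families \<open>F j\<close> and weights \<open>s\<close> are general so that one block may
  carry an elementary symmetric sum instead of a truncation.\<close>

lemma sieve_level_blocks:
  fixes P :: "'i \<Rightarrow> nat set" and s :: "'i \<Rightarrow> nat set \<Rightarrow> real"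
  assumes A: "finite A" "disjoint_family_on P A"
    and P: "\<And>j. j \<in> A \<Longrightarrow> finite (P j)" "\<And>j p. j \<in> A \<Longrightarrow> p \<in> P j \<Longrightarrow> prime p \<and> R p \<subseteq> {..<p}"
    and F: "\<And>j. j \<in> A \<Longrightarrow> F j \<subseteq> Pow (P j)" and s: "\<And>j D. \<bar>s j D\<bar> \<le> 1"
  shows "\<bar>(\<Sum>k<X. \<Prod>j\<in>A. \<Sum>D\<in>F j. s j D * (\<Prod>p\<in>D. in_residues R k p))
      - real X * (\<Prod>j\<in>A. \<Sum>D\<in>F j. s j D * (\<Prod>p\<in>D. real (card (R p)) / real p))\<bar>
    \<le> (\<Prod>j\<in>A. \<Sum>D\<in>F j. \<Prod>p\<in>D. real (card (R p)))"
proof -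
  have finF: "finite (F j)" if "j \<in> A" for j
    using F[OF that] P(1)[OF that] by (auto intro: finite_subset)
  let ?H = "PiE A F"
  have H: "finite (h j)" "h j \<subseteq> P j" if "h \<in> ?H" "j \<in> A" for h j
  proof -
    have "h j \<in> F j" using that by auto
    then show "h j \<subseteq> P j" using F[OF that(2)] by auto
    then show "finite (h j)" using P(1)[OF that(2)] by (rule finite_subset)
  qed
  have merge: "(\<Prod>j\<in>A. \<Prod>p\<in>h j. f p) = (\<Prod>p\<in>(\<Union>j\<in>A. h j). (f p :: real))" if "h \<in> ?H" for h f
  proof (rule prod.UNION_disjoint[symmetric, OF A(1)])
    show "\<forall>i\<in>A. finite (h i)" using H[OF that] by blast
    show "\<forall>i\<in>A. \<forall>j\<in>A. i \<noteq> j \<longrightarrow> h i \<inter> h j = {}"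
      using H(2)[OF that] A(2) unfolding disjoint_family_on_def by blast
  qed
  have expand: "(\<Prod>j\<in>A. \<Sum>D\<in>F j. s' j D * (\<Prod>p\<in>D. f p)) =
     (\<Sum>h\<in>?H. (\<Prod>j\<in>A. s' j (h j)) * (\<Prod>p\<in>(\<Union>j\<in>A. h j). (f p :: real)))" for s' f
  proof -
    have "(\<Prod>j\<in>A. \<Sum>D\<in>F j. s' j D * (\<Prod>p\<in>D. f p)) = (\<Sum>h\<in>?H. \<Prod>j\<in>A. s' j (h j) * (\<Prod>p\<in>h j. f p))"
      by (rule prod_sum_PiE) (use A finF in auto)
    then show ?thesis by (simp add: prod.distrib merge cong: sum.cong)
  qed
  have "(\<Sum>k<X. \<Prod>j\<in>A. \<Sum>D\<in>F j. s j D * (\<Prod>p\<in>D. in_residues R k p))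
     = (\<Sum>h\<in>?H. (\<Prod>j\<in>A. s j (h j)) * (\<Sum>k<X. \<Prod>p\<in>(\<Union>j\<in>A. h j). in_residues R k p))"
    unfolding expand by (subst sum.swap) (simp add: sum_distrib_left)
  moreover have "real X * (\<Prod>j\<in>A. \<Sum>D\<in>F j. s j D * (\<Prod>p\<in>D. real (card (R p)) / real p))
     = (\<Sum>h\<in>?H. (\<Prod>j\<in>A. s j (h j)) * (real X * (\<Prod>p\<in>(\<Union>j\<in>A. h j). real (card (R p)) / real p)))"
    unfolding expand by (simp add: sum_distrib_left mult.left_commute)
  ultimately have "\<bar>(\<Sum>k<X. \<Prod>j\<in>A. \<Sum>D\<in>F j. s j D * (\<Prod>p\<in>D. in_residues R k p))
      - real X * (\<Prod>j\<in>A. \<Sum>D\<in>F j. s j D * (\<Prod>p\<in>D. real (card (R p)) / real p))\<bar>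
    = \<bar>\<Sum>h\<in>?H. (\<Prod>j\<in>A. s j (h j)) * ((\<Sum>k<X. \<Prod>p\<in>(\<Union>j\<in>A. h j). in_residues R k p)
       - real X * (\<Prod>p\<in>(\<Union>j\<in>A. h j). real (card (R p)) / real p))\<bar>"
    by (simp add: sum_subtractf right_diff_distrib)
  also have "\<dots> \<le> (\<Sum>h\<in>?H. \<Prod>p\<in>(\<Union>j\<in>A. h j). real (card (R p)))"
  proof (intro order_trans[OF sum_abs] sum_mono)
    fix h assume h: "h \<in> ?H"
    let ?S = "\<Union>j\<in>A. h j"
    have "\<bar>(\<Prod>j\<in>A. s j (h j))\<bar> \<le> 1"
      unfolding abs_prod using s by (intro prod_le_1) auto
    moreover have "\<bar>(\<Sum>k<X. \<Prod>p\<in>?S. in_residues R k p) - real X * (\<Prod>p\<in>?S. real (card (R p)) / real p)\<bar>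
       \<le> (\<Prod>p\<in>?S. real (card (R p)))"
      using A H[OF h] P(2) by (intro sieve_level) blast+
    ultimately show "\<bar>(\<Prod>j\<in>A. s j (h j)) * ((\<Sum>k<X. \<Prod>p\<in>?S. in_residues R k p)
       - real X * (\<Prod>p\<in>?S. real (card (R p)) / real p))\<bar> \<le> (\<Prod>p\<in>?S. real (card (R p)))"
      unfolding abs_mult using mult_mono[of _ 1 _ "\<Prod>p\<in>?S. real (card (R p))"] by fastforce
  qed
  also have "\<dots> = (\<Prod>j\<in>A. \<Sum>D\<in>F j. \<Prod>p\<in>D. real (card (R p)))"
    using expand[of "\<lambda>_ _. 1" "\<lambda>p. real (card (R p))"] by simp
  finally show ?thesis .
qed

text \<open>With G the sum of g, the part of degree m is at most G^m <= (b choose m) G^m, and these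
  add up to (1 + G)^b.\<close>

lemma sum_bounded_subsets_le:
  fixes g :: "'a \<Rightarrow> real"
  assumes "finite P" "\<And>p. p \<in> P \<Longrightarrow> 0 \<le> g p" "1 + (\<Sum>p\<in>P. g p) \<le> u"
  shows "(\<Sum>D | D \<subseteq> P \<and> card D \<le> b. \<Prod>p\<in>D. g p) \<le> u ^ b"
proof -
  let ?G = "\<Sum>p\<in>P. g p"
  have G: "?G \<ge> 0" by (intro sum_nonneg assms(2))
  have "(\<Sum>D | D \<subseteq> P \<and> card D \<le> b. \<Prod>p\<in>D. g p) = (\<Sum>D\<in>(\<Union>m\<le>b. {D. D \<subseteq> P \<and> card D = m}). \<Prod>p\<in>D. g p)"
    by (intro sum.cong) auto
  also have "\<dots> = (\<Sum>m\<le>b. elem_sym m P g)"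
    unfolding elem_sym_def using assms(1) by (intro sum.UNION_disjoint) auto
  also have "\<dots> \<le> (\<Sum>m\<le>b. real (b choose m) * ?G ^ m)"
  proof (rule sum_mono)
    fix m assume m: "m \<in> {..b}"
    have "elem_sym m P g \<le> ?G ^ m / fact m" using assms by (intro elem_sym_le)
    also have "\<dots> \<le> ?G ^ m / 1" using G by (intro divide_left_mono) auto
    also have "\<dots> \<le> real (b choose m) * ?G ^ m"
      using G m mult_right_mono[of 1 "real (b choose m)" "?G ^ m"]
      by (simp add: Suc_le_eq zero_less_binomial_iff)
    finally show "elem_sym m P g \<le> real (b choose m) * ?G ^ m" .
  qed
  also have "\<dots> = (?G + 1) ^ b" by (simp add: binomial_ring)
  also have "\<dots> \<le> u ^ b" using assms G by (intro power_mono) auto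
  finally show ?thesis .
qed

text \<open>
  Weight k by the product over all blocks of the even Bonferroni sums, which is nonnegative.
  If every k met some \<open>R p\<close>, then for each k some block would have Bonferroni sum at most
  the elementary symmetric sum of degree \<open>b j + 1\<close>; averaging over k bounds the mean
  weight by \<open>\<Sum>j. c j\<close> times itself, up to the errors.
\<close>
theorem brun_hooley:
  fixes P :: "nat \<Rightarrow> nat set" and R :: "nat \<Rightarrow> nat set" and c u :: "nat \<Rightarrow> real"
  defines "g \<equiv> \<lambda>p. real (card (R p)) / real p"
  assumes P: "disjoint_family_on P {..<J}" "\<And>j. j < J \<Longrightarrow> finite (P j)"
    and R: "\<And>j p. j < J \<Longrightarrow> p \<in> P j \<Longrightarrow> prime p \<and> R p \<subseteq> {..<p}"
    and b: "\<And>j. j < J \<Longrightarrow> even (b j)"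
    and u: "\<And>j. j < J \<Longrightarrow> 1 + (\<Sum>p\<in>P j. real (card (R p))) \<le> u j"
    and c: "\<And>j. j < J \<Longrightarrow> elem_sym (Suc (b j)) (P j) g \<le> c j * (\<Prod>p\<in>P j. 1 - g p)"
    and c0: "\<And>j. j < J \<Longrightarrow> c j \<ge> 0" and c1: "(\<Sum>j<J. c j) \<le> 1"
    and main: "(\<Prod>j<J. u j ^ b j) * (1 + (\<Sum>j<J. u j))
       < real X * (\<Prod>j<J. \<Prod>p\<in>P j. 1 - g p) * (1 - (\<Sum>j<J. c j))"
  shows "\<exists>k<X. \<forall>j<J. \<forall>p\<in>P j. k mod p \<notin> R p"
proof (rule ccontr)
  assume neg: "\<not> ?thesis"
  let ?I = "in_residues R"
  have I01: "0 \<le> ?I k p \<and> ?I k p \<le> 1" for k p by (simp add: in_residues_def)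
  have g01: "0 \<le> g p \<and> g p \<le> 1" if "j < J" "p \<in> P j" for j p
    using R[OF that] card_mono[of "{..<p}" "R p"] by (auto simp: g_def divide_simps)
  define Err where "Err = (\<Prod>j<J. u j ^ b j)"
  have u1: "u j \<ge> 1" if "j < J" for j
    using u[OF that] sum_nonneg[of "P j" "\<lambda>p. real (card (R p))"] by auto
  define M where "M j = bonferroni (b j) (P j) g" for j
  define V where "V j = (\<Prod>p\<in>P j. 1 - g p)" for j
  have MV: "V j \<le> M j" "V j \<ge> 0" if "j < J" for j
    using bonferroni_bounds[of "P j" g "b j"] P(2) g01 b that
    by (auto simp: M_def V_def intro!: prod_nonneg)
  have bonf_nn: "bonferroni (b j) (P j) (?I k) \<ge> 0" if "j < J" for j k
    using bonferroni_bounds[of "P j" "?I k" "b j"] P(2)[OF that] I01 b[OF that]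
    by (auto intro: order_trans[rotated] intro!: prod_nonneg)
  \<comment> \<open>The product of all truncations, with the one of block l exchanged for the
    elementary symmetric sum of the next degree.\<close>
  define T where "T l k = (\<Prod>j<J. if j = l then elem_sym (Suc (b j)) (P j) (?I k)
                                  else bonferroni (b j) (P j) (?I k))" for l k
  have esym_nn: "elem_sym m (P j) (?I k) \<ge> 0" for m j k
    using I01 by (intro elem_sym_nonneg) auto
  have T_nn: "T l k \<ge> 0" for l k
    unfolding T_def using bonf_nn esym_nn by (intro prod_nonneg) auto

  have upper: "(\<Prod>j<J. bonferroni (b j) (P j) (?I k)) \<le> (\<Sum>l<J. T l k)" if k: "k < X" for k
  proof -
    from neg k obtain l p where l: "l < J" "p \<in> P l" "k mod p \<in> R p" by blast
    have V0: "(\<Prod>p\<in>P l. 1 - ?I k p) = 0"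
      using P(2) l by (auto simp: prod_zero_iff in_residues_def)
    have le: "bonferroni (b l) (P l) (?I k) \<le> elem_sym (Suc (b l)) (P l) (?I k)"
      using bonferroni_le[where g = "?I k", OF P(2)[OF l(1)] I01 b[OF l(1)]] by (simp only: V0 add_0_left)
    have "(\<Prod>j<J. bonferroni (b j) (P j) (?I k)) \<le> T l k"
      unfolding T_def using le bonf_nn by (intro prod_mono) auto
    also have "\<dots> \<le> (\<Sum>l<J. T l k)" using l T_nn by (intro member_le_sum) auto
    finally show ?thesis .
  qed

  have bonf_err: "(\<Sum>D | D \<subseteq> P j \<and> card D \<le> b j. \<Prod>p\<in>D. real (card (R p))) \<le> u j ^ b j" if "j < J" for j
    using P(2)[OF that] u[OF that] by (intro sum_bounded_subsets_le) auto
  have esym_err: "(\<Sum>D | D \<subseteq> P j \<and> card D = Suc (b j). \<Prod>p\<in>D. real (card (R p))) \<le> u j ^ Suc (b j)" if "j < J" for j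
  proof -
    have "(\<Sum>D | D \<subseteq> P j \<and> card D = Suc (b j). \<Prod>p\<in>D. real (card (R p)))
        \<le> (\<Sum>D | D \<subseteq> P j \<and> card D \<le> Suc (b j). \<Prod>p\<in>D. real (card (R p)))"
      using P(2)[OF that] by (intro sum_mono2) (auto intro!: prod_nonneg)
    also have "\<dots> \<le> u j ^ Suc (b j)"
      using P(2)[OF that] u[OF that] by (intro sum_bounded_subsets_le) auto
    finally show ?thesis .
  qed

  have lower: "real X * (\<Prod>j<J. M j) - Err \<le> (\<Sum>k<X. \<Prod>j<J. bonferroni (b j) (P j) (?I k))"
  proof -
    have "\<bar>(\<Sum>k<X. \<Prod>j<J. bonferroni (b j) (P j) (?I k)) - real X * (\<Prod>j<J. M j)\<bar>
       \<le> (\<Prod>j<J. \<Sum>D | D \<subseteq> P j \<and> card D \<le> b j. \<Prod>p\<in>D. real (card (R p)))"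
      unfolding bonferroni_def M_def g_def
      using P R by (intro sieve_level_blocks) auto
    also have "\<dots> \<le> Err"
      unfolding Err_def using bonf_err by (intro prod_mono) (auto intro!: sum_nonneg prod_nonneg)
    finally show ?thesis by linarith
  qed

  \<comment> \<open>The degree in block l is one higher, which multiplies the error by
    \<open>u l\<close>; hypothesis \<open>c\<close> together with V <= M bounds the change of the
    main term by the factor \<open>c l\<close>.\<close>
  have Tsum: "(\<Sum>k<X. T l k) \<le> real X * c l * (\<Prod>j<J. M j) + Err * u l" if l: "l < J" for l
  proof -
    define F where "F j = (if j = l then {D. D \<subseteq> P j \<and> card D = Suc (b j)} else {D. D \<subseteq> P j \<and> card D \<le> b j})" for j
    define s where "s j D = (if j = l then 1 else (-1::real) ^ card D)" for j and D :: "nat set"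
    have Feq: "(\<Sum>D\<in>F j. s j D * (\<Prod>p\<in>D. f p)) = (if j = l then elem_sym (Suc (b j)) (P j) f else bonferroni (b j) (P j) f)" for j f
      by (simp add: F_def s_def elem_sym_def bonferroni_def)
    have "\<bar>(\<Sum>k<X. \<Prod>j<J. \<Sum>D\<in>F j. s j D * (\<Prod>p\<in>D. ?I k p))
        - real X * (\<Prod>j<J. \<Sum>D\<in>F j. s j D * (\<Prod>p\<in>D. real (card (R p)) / real p))\<bar>
       \<le> (\<Prod>j<J. \<Sum>D\<in>F j. \<Prod>p\<in>D. real (card (R p)))"
      using P R by (intro sieve_level_blocks) (auto simp: F_def s_def)
    also have "\<dots> \<le> (\<Prod>j<J. if j = l then u j ^ Suc (b j) else u j ^ b j)"
      using bonf_err esym_err by (intro prod_mono) (auto simp: F_def intro!: sum_nonneg prod_nonneg)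
    also have "\<dots> = (\<Prod>j<J. u j ^ b j * (if j = l then u j else 1))"
      by (intro prod.cong) auto
    also have "\<dots> = Err * u l"
      unfolding Err_def prod.distrib using l by (simp add: prod.delta)
    finally have "\<bar>(\<Sum>k<X. T l k) - real X * (\<Prod>j<J. if j = l then elem_sym (Suc (b j)) (P j) g else M j)\<bar> \<le> Err * u l"
      unfolding Feq T_def M_def g_def .
    moreover have "(\<Prod>j<J. if j = l then elem_sym (Suc (b j)) (P j) g else M j) \<le> (\<Prod>j<J. M j * (if j = l then c j else 1))"
    proof (intro prod_mono conjI)
      fix j assume "j \<in> {..<J}"
      then have j: "j < J" by simp
      show "0 \<le> (if j = l then elem_sym (Suc (b j)) (P j) g else M j)"
        using MV[OF j] g01[OF j] by (auto intro!: elem_sym_nonneg)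
      have "c j * V j \<le> M j * c j" using MV[OF j] c0[OF j] by (simp add: mult.commute mult_right_mono)
      then show "(if j = l then elem_sym (Suc (b j)) (P j) g else M j) \<le> M j * (if j = l then c j else 1)"
        using c[OF j] by (auto simp: V_def)
    qed
    then have "real X * (\<Prod>j<J. if j = l then elem_sym (Suc (b j)) (P j) g else M j) \<le> real X * ((\<Prod>j<J. M j) * c l)"
      unfolding prod.distrib using l by (intro mult_left_mono) (auto simp: prod.delta)
    ultimately show ?thesis by (simp add: algebra_simps)
  qed

  have "real X * (\<Prod>j<J. M j) - Err \<le> (\<Sum>k<X. \<Sum>l<J. T l k)"
    using lower upper by (intro order_trans[OF lower] sum_mono) auto
  also have "\<dots> = (\<Sum>l<J. \<Sum>k<X. T l k)" by (rule sum.swap)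
  also have "\<dots> \<le> (\<Sum>l<J. real X * c l * (\<Prod>j<J. M j) + Err * u l)"
    using Tsum by (intro sum_mono) auto
  also have "\<dots> = real X * (\<Prod>j<J. M j) * (\<Sum>l<J. c l) + Err * (\<Sum>l<J. u l)"
    by (simp add: sum.distrib sum_distrib_left sum_distrib_right mult_ac)
  finally have "real X * (\<Prod>j<J. M j) * (1 - (\<Sum>l<J. c l)) \<le> Err * (1 + (\<Sum>l<J. u l))"
    by (simp add: algebra_simps)
  \<comment> \<open>Only now are the truncated main terms M replaced by the true products V; 1 - sum
    of c is nonnegative, so the direction is preserved.\<close>
  moreover have "real X * (\<Prod>j<J. V j) * (1 - (\<Sum>l<J. c l)) \<le> real X * (\<Prod>j<J. M j) * (1 - (\<Sum>l<J. c l))"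
    using MV c1 by (intro mult_right_mono mult_left_mono prod_mono) auto
  ultimately show False using main unfolding Err_def V_def by linarith
qed

section \<open>Sieving up to the sixteenth root\<close>

text \<open>For x = n/m, comparing m-th powers and using e < 2.72 reduces the bound to rational
  arithmetic.\<close>

lemma exp_le_power:
  assumes "a \<ge> 0" "real m * x = real n" "(272/100) ^ n \<le> a ^ m" "m > 0"
  shows "exp x \<le> (a::real)"
proof -
  have "exp x ^ m = exp 1 ^ n"
    using assms(2) by (simp add: exp_of_nat_mult[symmetric])
  also have "\<dots> \<le> (272/100) ^ n"
    using e_less_272 by (intro power_mono) auto
  also have "\<dots> \<le> a ^ m" by fact
  finally show ?thesis using assms by (simp add: power_mono_iff)
qed

lemma ln_2_ge: "ln 2 \<ge> (11/16::real)"
proof -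
  have "exp (11/16) \<le> (2::real)"
    by (rule exp_le_power[of _ 16 _ 11]) (simp_all add: power_divide divide_simps)
  then show ?thesis by (subst ln_ge_iff) auto
qed

text \<open>Raising the degree from k to k+2 multiplies by B^2/((k+1)(k+2)), at most 1/2 once k >=
  n. The degrees rise by two per block, so the losses decay geometrically.\<close>

lemma power_over_fact_halving:
  fixes B :: real
  assumes "0 \<le> B" "2 * B\<^sup>2 \<le> real ((n + 1) * (n + 2))"
  shows "B ^ (n + 2 * i) / fact (n + 2 * i) \<le> B ^ n / fact n / 2 ^ i"
proof (induction i)
  case (Suc i)
  let ?m = "n + 2 * i"
  have "2 * B\<^sup>2 \<le> (real n + 1) * (real n + 2)" using assms(2) by (simp add: algebra_simps)
  also have "\<dots> \<le> (real ?m + 1) * (real ?m + 2)" by (intro mult_mono) auto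
  finally have "2 * B\<^sup>2 \<le> (real ?m + 1) * (real ?m + 2)" .
  then have *: "B\<^sup>2 / ((real ?m + 1) * (real ?m + 2)) \<le> 1 / 2"
    by (simp add: divide_simps)
  have "B ^ (n + 2 * Suc i) / fact (n + 2 * Suc i)
      = B ^ ?m / fact ?m * (B\<^sup>2 / ((real ?m + 1) * (real ?m + 2)))"
    by (simp add: power2_eq_square divide_simps) (simp add: algebra_simps)
  also have "\<dots> \<le> B ^ ?m / fact ?m * (1 / 2)"
    using * assms(1) by (intro mult_left_mono) auto
  also have "\<dots> \<le> B ^ n / fact n / 2 ^ i * (1 / 2)"
    using Suc by (intro mult_right_mono) auto
  finally show ?case by simp
qed simp

text \<open>
  The relative loss of block j when \<open>b j = 2 * j + 4\<close>. Only the first block, where the sum G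
  of the densities is about \<open>58/35 < 17/10\<close>, is expensive; the total must stay below 1.
\<close>
definition block_loss :: "nat \<Rightarrow> real" where
  "block_loss j = (if j = 0 then 7/10 else if j = 1 then 1/20 else 1 / (10 * 2 ^ (j - 2)))"

lemma block_loss_nonneg: "block_loss j \<ge> 0"
  by (simp add: block_loss_def)

lemma sum_block_loss: "(\<Sum>j<J. block_loss j) \<le> 19/20"
proof -
  have *: "(\<Sum>j<i+2. block_loss j) = 19/20 - 1 / (5 * 2 ^ i)" for i
  proof (induction i)
    case (Suc i)
    have "block_loss (i + 2) = 1 / (10 * 2 ^ i)" by (simp add: block_loss_def)
    then show ?case using Suc by simp
  qed (simp add: block_loss_def numeral_2_eq_2)
  show ?thesis
  proof (cases "J < 2")
    case True
    then have "J = 0 \<or> J = 1" by auto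
    then show ?thesis by (auto simp: block_loss_def)
  next
    case False
    then have "J - 2 + 2 = J" by simp
    moreover have "19/20 - 1 / (5 * 2 ^ (J - 2)) \<le> (19/20 :: real)" by simp
    ultimately show ?thesis using *[of "J - 2"] by simp
  qed
qed

text \<open>The exponential compensates for dividing by the product of 1 - g p, see
  \<open>prod_one_minus_ge_exp\<close>. The available bound on G weakens for later blocks, but there
  the factorial has grown enough.\<close>

lemma block_loss_bound:
  assumes "0 \<le> G" "j < 2 \<Longrightarrow> G \<le> 17/10" "j < 6 \<Longrightarrow> G \<le> 23/10" "G \<le> 4"
  shows "G ^ (2 * j + 5) / fact (2 * j + 5) * exp (101/100 * G) \<le> block_loss j"
proof -
  have mono: "G ^ n / fact n * exp (101/100 * G) \<le> B ^ n / fact n * E"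
    if "G \<le> B" "exp e \<le> E" "101/100 * B \<le> e" for B n e E
  proof -
    have "101/100 * G \<le> e" using that by linarith
    then have "exp (101/100 * G) \<le> E" using that(2) by (meson exp_le_cancel_iff order_trans)
    then show ?thesis using that assms(1)
      by (intro mult_mono divide_right_mono power_mono) auto
  qed
  have e1: "exp (7/4) \<le> (577/100::real)"
    by (rule exp_le_power[of _ 4 _ 7]) (simp_all add: power_divide divide_simps)
  have e2: "exp (7/3) \<le> (1033/100::real)"
    by (rule exp_le_power[of _ 3 _ 7]) (simp_all add: power_divide divide_simps)
  have e3: "exp (9/2) \<le> (91::real)"
    by (rule exp_le_power[of _ 2 _ 9]) (simp_all add: power_divide divide_simps)
  have "j = 0 \<or> j = 1 \<or> (\<exists>i. j = i + 2 \<and> i < 4) \<or> (\<exists>i. j = i + 6)" by presburger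
  then consider "j = 0" | "j = 1" | i where "j = i + 2" "i < 4" | i where "j = i + 6" by blast
  then show ?thesis
  proof cases
    case 1
    have "G ^ 5 / fact 5 * exp (101/100 * G) \<le> (17/10) ^ 5 / fact 5 * (577/100)"
      using 1 assms by (intro mono[OF _ e1]) auto
    also have "\<dots> \<le> 7/10" by (simp add: power_divide fact_numeral)
    finally show ?thesis using 1 by (simp add: block_loss_def)
  next
    case 2
    have "G ^ 7 / fact 7 * exp (101/100 * G) \<le> (17/10) ^ 7 / fact 7 * (577/100)"
      using 2 assms by (intro mono[OF _ e1]) auto
    also have "\<dots> \<le> 1/20" by (simp add: power_divide fact_numeral)
    finally show ?thesis using 2 by (simp add: block_loss_def)
  next
    case (3 i)
    have "G ^ (9 + 2 * i) / fact (9 + 2 * i) * exp (101/100 * G)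
        \<le> (23/10) ^ (9 + 2 * i) / fact (9 + 2 * i) * (1033/100)"
      using 3 assms by (intro mono[OF _ e2]) auto
    also have "\<dots> \<le> (23/10) ^ 9 / fact 9 / 2 ^ i * (1033/100)"
      by (intro mult_right_mono power_over_fact_halving) (auto simp: power2_eq_square)
    also have "\<dots> = (23/10) ^ 9 / fact 9 * (1033/100) / 2 ^ i" by simp
    also have "\<dots> \<le> (1/10) / 2 ^ i"
      by (intro divide_right_mono) (simp_all add: power_divide fact_numeral)
    finally show ?thesis using 3 by (simp add: block_loss_def algebra_simps)
  next
    case (4 i)
    have "G ^ (17 + 2 * i) / fact (17 + 2 * i) * exp (101/100 * G)
        \<le> 4 ^ (17 + 2 * i) / fact (17 + 2 * i) * 91"
      using 4 assms by (intro mono[OF _ e3]) auto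
    also have "\<dots> \<le> 4 ^ 17 / fact 17 / 2 ^ i * 91"
      by (intro mult_right_mono power_over_fact_halving) (auto simp: power2_eq_square)
    also have "\<dots> = 4 ^ 17 / fact 17 * 91 / 2 ^ i" by simp
    also have "\<dots> \<le> (1/160) / 2 ^ i"
      by (intro divide_right_mono) (simp_all add: power_divide fact_numeral)
    finally show ?thesis using 4 by (simp add: block_loss_def algebra_simps power_add)
  qed
qed

text \<open>This is the level of the sieve: blocks ending at exp(t/2^j) with degrees 2j+4 give a
  total error of at most exp(12 t).\<close>

lemma sum_levels: "(\<Sum>j<J. real (2 * j + 4) / 2 ^ j) \<le> 12"
proof -
  \<comment> \<open>The subtracted term is the tail of the series from J on.\<close>
  have "(\<Sum>j<J. real (2 * j + 4) / 2 ^ j) = 12 - (4 * real J + 12) / 2 ^ J"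
  proof (induction J)
    case (Suc J)
    have "real (2 * J + 4) / 2 ^ J = (4 * real J + 12) / 2 ^ J - (4 * real (Suc J) + 12) / 2 ^ Suc J"
      by (simp add: field_simps)
    then show ?case using Suc by simp
  qed simp
  then show ?thesis by simp
qed

section \<open>Counts and products over odd primes\<close>

lemma odd_primes_subset:
  "{p::nat. prime p \<and> 2 < p \<and> real p \<le> v} \<subseteq> (\<lambda>i. 2 * i + 1) ` {1..nat \<lfloor>(v - 1) / 2\<rfloor>}"
proof
  fix p assume p: "p \<in> {p::nat. prime p \<and> 2 < p \<and> real p \<le> v}"
  then have "odd p" using prime_odd_nat[of p] by auto
  then obtain i where i: "p = 2 * i + 1" by (elim oddE)
  have "real i \<le> (v - 1) / 2" using p i by simp
  then show "p \<in> (\<lambda>i. 2 * i + 1) ` {1..nat \<lfloor>(v - 1) / 2\<rfloor>}"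
    using p i by (auto simp: le_nat_floor)
qed

text \<open>Oddness of the primes pays exactly for the two residues removed per prime, so the error
  base \<open>u j\<close> can be the right end of the block.\<close>

lemma card_odd_primes:
  assumes "v \<ge> 1" "S \<subseteq> {p::nat. prime p \<and> 2 < p \<and> real p \<le> v}"
  shows "1 + 2 * real (card S) \<le> v"
proof -
  have "card S \<le> card ((\<lambda>i. 2 * i + 1) ` {1..nat \<lfloor>(v - 1) / 2\<rfloor>})"
    using assms(2) odd_primes_subset[of v] by (intro card_mono) auto
  also have "\<dots> \<le> nat \<lfloor>(v - 1) / 2\<rfloor>" using card_image_le[of "{1..nat \<lfloor>(v - 1) / 2\<rfloor>}"] by simp
  finally have "real (card S) \<le> real (nat \<lfloor>(v - 1) / 2\<rfloor>)" by (rule of_nat_mono)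
  also have "\<dots> \<le> (v - 1) / 2" using assms(1) by (intro of_nat_floor) simp
  finally show ?thesis by simp
qed

text \<open>Over all odd integers from 3 to 2m+1 the product telescopes to 1/(2m+1), and deleting
  factors only increases it. Far from the true order of magnitude, but it costs just one factor
  exp(-t).\<close>

lemma prod_odd_primes_ge:
  assumes "v \<ge> 1" "S \<subseteq> {p::nat. prime p \<and> 2 < p \<and> real p \<le> v}"
  shows "(\<Prod>p\<in>S. 1 - 2 / real p) \<ge> 1 / v"
proof -
  define m where "m = nat \<lfloor>(v - 1) / 2\<rfloor>"
  let ?O = "(\<lambda>i. 2 * i + 1) ` {1..m}"
  have m: "2 * real m + 1 \<le> v" using assms(1) of_nat_floor[of "(v-1)/2"] unfolding m_def by simp
  have sub: "S \<subseteq> ?O" using assms(2) odd_primes_subset[of v] unfolding m_def by auto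
  have "1 / v \<le> 1 / (2 * real m + 1)" using m by (intro divide_left_mono) auto
  also have "\<dots> = (\<Prod>i=1..m. 1 - 2 / (2 * real i + 1))"
    by (induction m) (simp_all add: field_simps)
  also have "\<dots> = (\<Prod>p\<in>?O. 1 - 2 / real p)"
    by (subst prod.reindex) (auto simp: inj_on_def add.commute)
  also have "\<dots> = (\<Prod>p\<in>S. 1 - 2 / real p) * (\<Prod>p\<in>?O - S. 1 - 2 / real p)"
    using prod.subset_diff[OF sub, of "\<lambda>p. 1 - 2 / real p"] by (simp add: mult.commute)
  also have "\<dots> \<le> (\<Prod>p\<in>S. 1 - 2 / real p) * 1"
    using sub by (intro mult_left_mono prod_le_1 prod_nonneg) (auto simp: divide_simps)
  finally show ?thesis by simp
qed

text \<open>For 0 <= x <= 1/200, log(1 - x) >= -x - 2x^2 >= -(101/100) x.\<close>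

lemma prod_one_minus_ge_exp:
  fixes g :: "'a \<Rightarrow> real"
  assumes "finite S" "\<And>p. p \<in> S \<Longrightarrow> 0 \<le> g p \<and> g p \<le> 1/200"
  shows "(\<Prod>p\<in>S. 1 - g p) \<ge> exp (- (101/100) * (\<Sum>p\<in>S. g p))"
proof -
  have "exp (- (101/100) * (\<Sum>p\<in>S. g p)) = (\<Prod>p\<in>S. exp (- (101/100) * g p))"
    using assms(1) by (simp add: exp_sum sum_distrib_left)
  also have "\<dots> \<le> (\<Prod>p\<in>S. 1 - g p)"
  proof (intro prod_mono conjI)
    fix p assume p: "p \<in> S"
    have g: "0 \<le> g p" "g p \<le> 1/200" using assms(2)[OF p] by auto
    have "g p * g p \<le> 1/200 * g p" using g by (intro mult_right_mono) auto
    then have "- (101/100) * g p \<le> - g p - 2 * (g p)\<^sup>2"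
      by (simp add: power2_eq_square)
    also have "\<dots> \<le> ln (1 - g p)"
      using g by (intro ln_one_minus_pos_lower_bound) auto
    finally show "exp (- (101/100) * g p) \<le> 1 - g p"
      using g by (subst (asm) ln_ge_iff) auto
  qed auto
  finally show ?thesis .
qed

section \<open>Choice of the blocks and of the parameters\<close>

lemma large_sieve_nonempty:
  fixes t :: real and X :: nat and R :: "nat \<Rightarrow> nat set"
  assumes t: "t \<ge> 1400"
    and R: "\<And>p. prime p \<Longrightarrow> t / 3 < real p \<Longrightarrow> real p \<le> exp t \<Longrightarrow> R p \<subseteq> {..<p} \<and> card (R p) \<le> 2"
    and X: "exp (15 * t) \<le> real X"
  shows "\<exists>k<X. \<forall>p. prime p \<longrightarrow> t / 3 < real p \<longrightarrow> real p \<le> exp t \<longrightarrow> k mod p \<notin> R p"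
proof -
  define y where "y = t / 3"
  define g where "g = (\<lambda>p. real (card (R p)) / real p)"
  \<comment> \<open>466 lies just below 1400/3; it suffices for log y >= 6 and for 2/p <= 1/200
    beyond y.\<close>
  have y: "y \<ge> 466" using t by (simp add: y_def)
  have "exp 6 \<le> (466::real)"
    by (rule exp_le_power[of _ 1 _ 6]) (simp_all add: power_divide divide_simps)
  then have lny: "ln y \<ge> 6" using y by (subst ln_ge_iff) auto
  have ypos: "y > 1" using y by simp

  have "\<exists>J. t / 2 ^ J \<le> ln y"
  proof -
    obtain J where "t < 2 ^ J" using real_arch_pow[of 2 t] by auto
    then have "t / 2 ^ J \<le> 1" by (simp add: divide_simps)
    then show ?thesis using lny by (intro exI[of _ J]) linarith
  qed
  \<comment> \<open>Square roots are taken until exp(t/2^J) no longer exceeds y.\<close>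
  define J where "J = (LEAST J. t / 2 ^ J \<le> ln y)"
  have J: "t / 2 ^ J \<le> ln y" unfolding J_def using \<open>\<exists>J. _\<close> by (rule LeastI_ex)
  have lessJ: "ln y < t / 2 ^ j" if "j < J" for j
    using not_less_Least[of j "\<lambda>J. t / 2 ^ J \<le> ln y"] that unfolding J_def by auto
  have Jt: "real J \<le> t"
  proof (cases J)
    case (Suc i)
    have "1 < t / 2 ^ i" using lessJ[of i] lny Suc by linarith
    then have "2 ^ i < t" by (simp add: less_divide_eq)
    moreover have "real (Suc i) \<le> 2 ^ i"
      by (induction i) auto
    ultimately show ?thesis using Suc by simp
  qed (use t in simp)

  \<comment> \<open>The maximum cuts the last block off at y, so that \<open>w J\<close> =
    y.\<close>
  define w where "w j = max y (exp (t / 2 ^ j))" for j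
  have wpos: "w j > 1" "w j \<ge> y" for j using ypos by (auto simp: w_def)
  have ylt: "y < exp (t / 2 ^ j)" if "j < J" for j
    using lessJ[OF that] ypos by (metis exp_less_cancel_iff exp_ln less_trans zero_less_one)
  have w_eq: "w j = exp (t / 2 ^ j)" if "j < J" for j using ylt[OF that] by (simp add: w_def)
  have wJ: "w J = y"
  proof -
    have "exp (t / 2 ^ J) \<le> exp (ln y)" using J by simp
    then show ?thesis using ypos by (simp add: w_def)
  qed
  have wanti: "w j \<le> w i" if "i \<le> j" for i j
  proof -
    have "t / 2 ^ j \<le> t / 2 ^ i" using that t by (intro divide_left_mono) auto
    then show ?thesis unfolding w_def by (intro max.mono) auto
  qed
  have w_sq: "w j \<le> (w (Suc j))\<^sup>2" if "j < J" for j
  proof -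
    have "w j = (exp (t / 2 ^ Suc j))\<^sup>2"
      unfolding w_eq[OF that] by (simp add: exp_double[symmetric])
    also have "\<dots> \<le> (w (Suc j))\<^sup>2" by (intro power_mono) (auto simp: w_def)
    finally show ?thesis .
  qed
  have lnw: "ln (w (Suc j)) \<ge> 6" "ln (w (Suc j)) \<ge> t / 2 ^ Suc j" for j
  proof -
    have "ln y \<le> ln (w (Suc j))" using wpos ypos by (subst ln_le_cancel_iff) (auto simp: w_def)
    then show "ln (w (Suc j)) \<ge> 6" using lny by linarith
    show "ln (w (Suc j)) \<ge> t / 2 ^ Suc j"
      using wpos[of "Suc j"] by (subst ln_ge_iff) (auto simp: w_def)
  qed

  define P where "P j = {p. prime p \<and> w (Suc j) < real p \<and> real p \<le> w j}" for j
  have finP: "finite (P j)" for j unfolding P_def by simp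
  have inP: "prime p \<and> y < real p \<and> real p \<le> exp t" if "p \<in> P j" "j < J" for p j
    using that wpos(2)[of "Suc j"] wanti[of 0 j] w_eq[of 0] by (auto simp: P_def)
  have P_odd: "P j \<subseteq> {p. prime p \<and> 2 < p \<and> real p \<le> w j}" for j
  proof
    fix p assume p: "p \<in> P j"
    then have "2 < real p" using wpos(2)[of "Suc j"] y by (auto simp: P_def)
    then show "p \<in> {p. prime p \<and> 2 < p \<and> real p \<le> w j}" using p by (auto simp: P_def)
  qed
  have disj: "disjoint_family_on P {..<J}"
  proof -
    have "P i \<inter> P j = {}" if "i < j" for i j
      using wanti[of "Suc i" j] that by (auto simp: P_def)
    then show ?thesis unfolding disjoint_family_on_def by (metis Int_commute linorder_neqE_nat)
  qed
  have union: "\<exists>j<J. p \<in> P j" if "prime p" "y < real p" "real p \<le> exp t" for p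
  proof -
    have J0: "J > 0"
    proof (rule ccontr)
      assume "\<not> J > 0"
      then have "exp t \<le> y" using J ypos by (metis div_by_1 exp_ln exp_le_cancel_iff gr0I less_trans power_0 zero_less_one)
      then show False using that by linarith
    qed
    \<comment> \<open>The sequence w falls from exp t to y, and the first index at which it drops
      below p marks the lower end of the block of p.\<close>
    define i where "i = (LEAST i. w i < real p)"
    have ex: "\<exists>i. w i < real p" using wJ that by blast
    then have i: "w i < real p" unfolding i_def by (rule LeastI_ex)
    have "i \<noteq> 0" using i that w_eq[OF J0] by (intro notI) simp
    then obtain j where j: "i = Suc j" by (cases i) auto
    have "real p \<le> w j"
      using not_less_Least[of j "\<lambda>i. w i < real p"] j unfolding i_def by simp
    moreover have "j < J" using not_less_Least[of J "\<lambda>i. w i < real p"] Least_le[of "\<lambda>i. w i < real p" J] wJ that j unfolding i_def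
      by simp
    ultimately show ?thesis using i j that by (auto simp: P_def)
  qed

  have g: "0 \<le> g p \<and> g p \<le> 2 / real p \<and> g p \<le> 1/200" if "p \<in> P j" "j < J" for p j
  proof -
    have p: "prime p" "y < real p" "card (R p) \<le> 2" using inP[OF that] R[of p] by (auto simp: y_def)
    have "g p \<le> 2 / real p" unfolding g_def using p by (intro divide_right_mono) auto
    moreover have "2 / real p \<le> 2 / 466" using p y by (intro divide_left_mono) auto
    ultimately show ?thesis by (simp add: g_def)
  qed

  define G where "G j = (\<Sum>p\<in>P j. g p)" for j
  have G0: "G j \<ge> 0" for j unfolding G_def g_def by (intro sum_nonneg) auto
  have Gle: "G j \<le> 58/35 + 492/35 / ln (w (Suc j))" if "j < J" for j
  proof -
    have "G j \<le> (\<Sum>p\<in>P j. 2 * (1 / real p))" unfolding G_def using g that by (intro sum_mono) auto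
    also have "\<dots> = 2 * (\<Sum>p\<in>P j. 1 / real p)" by (simp add: sum_distrib_left)
    also have "\<dots> \<le> 2 * (29/35 + 246/35 / ln (w (Suc j)))"
      unfolding P_def using wpos[of "Suc j"] w_sq[OF that]
      by (intro mult_left_mono sum_inverse_prime_square_block) auto
    finally show ?thesis by simp
  qed
  \<comment> \<open>With log w >= 6 the bound is 58/35 + 82/35, exactly 4.\<close>
  have G_late: "G j \<le> 4" if "j < J" for j
  proof -
    have "492/35 / ln (w (Suc j)) \<le> 492/35 / 6" using lnw(1)[of j] by (intro divide_left_mono) auto
    then show ?thesis using Gle[OF that] by simp
  qed
  \<comment> \<open>Origin of 1400: for m = 2 and m = 6 the right side stays just below 17/10 and
    23/10.\<close>
  have G_early: "G j \<le> 58/35 + 492/35 * 2 ^ m / 1400" if "j < J" "Suc j \<le> m" for j m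
  proof -
    have "(2::real) ^ Suc j \<le> 2 ^ m" using that(2) by (intro power_increasing) auto
    then have "1400 / 2 ^ m \<le> t / 2 ^ Suc j" using t by (intro frac_le) auto
    then have "492/35 / ln (w (Suc j)) \<le> 492/35 / (1400 / 2 ^ m)"
      using lnw[of j] by (intro divide_left_mono) auto
    then show ?thesis using Gle[OF that(1)] by simp
  qed
  have loss: "elem_sym (Suc (2 * j + 4)) (P j) g \<le> block_loss j * (\<Prod>p\<in>P j. 1 - g p)" if "j < J" for j
  proof -
    have "elem_sym (Suc (2 * j + 4)) (P j) g \<le> G j ^ (2 * j + 5) / fact (2 * j + 5)"
      unfolding G_def using elem_sym_le[of "P j" g "Suc (2 * j + 4)"] finP g that by (auto simp: add.commute)
    also have "\<dots> = (G j ^ (2 * j + 5) / fact (2 * j + 5) * exp (101/100 * G j)) * exp (- (101/100) * G j)"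
      by (simp add: exp_minus)
    also have "\<dots> \<le> block_loss j * (\<Prod>p\<in>P j. 1 - g p)"
    proof (intro mult_mono block_loss_bound)
      show "exp (- (101/100) * G j) \<le> (\<Prod>p\<in>P j. 1 - g p)"
        unfolding G_def using finP g that by (intro prod_one_minus_ge_exp) auto
      show "G j \<le> 17/10" if "j < 2" using G_early[OF \<open>j < J\<close>, of 2] that by simp
      show "G j \<le> 23/10" if "j < 6" using G_early[OF \<open>j < J\<close>, of 6] that by simp
    qed (use G0 G_late[OF that] block_loss_nonneg in auto)
    finally show ?thesis .
  qed

  have V: "(\<Prod>j<J. \<Prod>p\<in>P j. 1 - g p) \<ge> exp (- t)"
  proof -
    let ?S = "\<Union>j\<in>{..<J}. P j"
    have "exp (- t) = 1 / exp t" by (simp add: exp_minus divide_inverse)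
    also have "\<dots> \<le> (\<Prod>p\<in>?S. 1 - 2 / real p)"
    proof (rule prod_odd_primes_ge)
      show "?S \<subseteq> {p. prime p \<and> 2 < p \<and> real p \<le> exp t}" using inP P_odd by blast
    qed (use t in simp)
    also have "\<dots> = (\<Prod>j<J. \<Prod>p\<in>P j. 1 - 2 / real p)"
      using finP disj by (intro prod.UNION_disjoint) (auto simp: disjoint_family_on_def)
    also have "\<dots> \<le> (\<Prod>j<J. \<Prod>p\<in>P j. 1 - g p)"
    proof (intro prod_mono conjI prod_nonneg)
      fix j p assume jp: "j \<in> {..<J}" "p \<in> P j"
      then have "p > 2" using P_odd by auto
      then show "0 \<le> 1 - 2 / real p" by (simp add: divide_simps)
      then show "0 \<le> 1 - 2 / real p" .
      show "1 - 2 / real p \<le> 1 - g p" using g[OF jp(2)] jp(1) by auto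
    qed
    finally show ?thesis .
  qed

  have E1: "(\<Prod>j<J. w j ^ (2 * j + 4)) \<le> exp (12 * t)"
  proof -
    have "(\<Prod>j<J. w j ^ (2 * j + 4)) = (\<Prod>j<J. exp (real (2 * j + 4) / 2 ^ j * t))"
      by (intro prod.cong refl) (simp add: w_eq exp_of_nat_mult[symmetric] del: of_nat_add of_nat_mult)
    also have "\<dots> = exp ((\<Sum>j<J. real (2 * j + 4) / 2 ^ j) * t)"
      by (simp add: exp_sum sum_distrib_right)
    also have "\<dots> \<le> exp (12 * t)" using sum_levels t by (simp add: mult_right_mono)
    finally show ?thesis .
  qed
  have E2: "(\<Sum>j<J. w j) \<le> t * exp t"
  proof -
    have "(\<Sum>j<J. w j) \<le> (\<Sum>j<J. exp t)"
    proof (intro sum_mono)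
      fix j assume "j \<in> {..<J}"
      then show "w j \<le> exp t" using wanti[of 0 j] w_eq[of 0] by simp
    qed
    also have "\<dots> \<le> t * exp t" using Jt by (simp add: mult_right_mono)
    finally show ?thesis .
  qed
  \<comment> \<open>Both sides have exponent 14t: 12t + 2t on the left, 15t - t on the right. The
    constants decide: 1/350 from t <= exp(t)/700 against the 1/20 left by the losses.\<close>
  have main: "(\<Prod>j<J. w j ^ (2 * j + 4)) * (1 + (\<Sum>j<J. w j))
       < real X * (\<Prod>j<J. \<Prod>p\<in>P j. 1 - g p) * (1 - (\<Sum>j<J. block_loss j))"
  proof -
    have et: "t * 700 \<le> exp t"
    proof -
      have "t * 1400 \<le> t * t" using t by (intro mult_left_mono) auto
      then have "t * 700 \<le> 1 + t + t\<^sup>2 / 2" unfolding power2_eq_square using t by linarith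
      also have "\<dots> \<le> exp t" using exp_lower_Taylor_quadratic[of t] t by simp
      finally show ?thesis .
    qed
    have "1 \<le> t * exp t" using t mult_mono[of 1 t 1 "exp t"] by simp
    have "(\<Prod>j<J. w j ^ (2 * j + 4)) * (1 + (\<Sum>j<J. w j)) \<le> exp (12 * t) * (1 + t * exp t)"
      using E1 E2 wpos by (intro mult_mono add_mono) (auto intro!: prod_nonneg add_nonneg_nonneg sum_nonneg simp: less_imp_le less_trans[OF zero_less_one])
    also have "\<dots> \<le> exp (12 * t) * (2 * (exp t / 700) * exp t)"
    proof -
      have "1 + t * exp t \<le> 2 * (t * exp t)" using \<open>1 \<le> t * exp t\<close> by simp
      also have "\<dots> \<le> 2 * ((exp t / 700) * exp t)" using et by (intro mult_left_mono mult_right_mono) auto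
      finally show ?thesis by (intro mult_left_mono) (auto simp: mult.assoc)
    qed
    also have "\<dots> = exp (15 * t) * exp (- t) * (1/350)"
      by (simp add: exp_add[symmetric] mult.assoc[symmetric])
    also have "\<dots> < exp (15 * t) * exp (- t) * (1/20)" by simp
    also have "\<dots> \<le> real X * (\<Prod>j<J. \<Prod>p\<in>P j. 1 - g p) * (1 - (\<Sum>j<J. block_loss j))"
      using X V sum_block_loss[of J] order_trans[OF exp_ge_zero V] by (intro mult_mono) auto
    finally show ?thesis .
  qed

  have "\<exists>k<X. \<forall>j<J. \<forall>p\<in>P j. k mod p \<notin> R p"
  proof (rule brun_hooley[where b = "\<lambda>j. 2 * j + 4" and u = w and c = block_loss])
    show "disjoint_family_on P {..<J}" by (rule disj)
    show "prime p \<and> R p \<subseteq> {..<p}" if "j < J" "p \<in> P j" for j p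
      using inP[OF that(2,1)] R[of p] by (auto simp: y_def)
    show "1 + (\<Sum>p\<in>P j. real (card (R p))) \<le> w j" if "j < J" for j
    proof -
      have "(\<Sum>p\<in>P j. real (card (R p))) \<le> (\<Sum>p\<in>P j. 2)"
        using inP[OF _ that] R by (intro sum_mono) (force simp: y_def)
      then show ?thesis using card_odd_primes[OF _ P_odd, of j] wpos[of j] by simp
    qed
    show "elem_sym (Suc (2 * j + 4)) (P j) (\<lambda>p. real (card (R p)) / real p)
        \<le> block_loss j * (\<Prod>p\<in>P j. 1 - real (card (R p)) / real p)" if "j < J" for j
      using loss[OF that] unfolding g_def .
    show "(\<Prod>j<J. w j ^ (2 * j + 4)) * (1 + (\<Sum>j<J. w j))
       < real X * (\<Prod>j<J. \<Prod>p\<in>P j. 1 - real (card (R p)) / real p) * (1 - (\<Sum>j<J. block_loss j))"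
      using main unfolding g_def .
    show "(\<Sum>j<J. block_loss j) \<le> 1" using sum_block_loss[of J] by simp
  qed (use finP block_loss_nonneg in auto)
  then show ?thesis using union unfolding y_def by blast
qed

section \<open>Prime factors of a(N-a)\<close>

lemma power_size_le_prod_mset:
  fixes z :: real
  assumes "z \<ge> 0" "\<And>p. p \<in># M \<Longrightarrow> z \<le> real p"
  shows "z ^ size M \<le> real (\<Prod>\<^sub># M)"
  using assms(2)
proof (induction M)
  case (add p M)
  then show ?case using assms(1) by (auto intro!: mult_mono)
qed simp

lemma power_size_large_factors_le:
  fixes z :: real
  assumes "n > 0" "z \<ge> 0"
  shows "z ^ size (filter_mset (\<lambda>p. z < real p \<and> A p) (prime_factorization n)) \<le> real n"
proof -
  let ?M = "filter_mset (\<lambda>p. z < real p \<and> A p) (prime_factorization n)"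
  have "\<Prod>\<^sub># ?M dvd \<Prod>\<^sub># (prime_factorization n)"
    by (intro prod_mset_subset_imp_dvd) simp
  then have "\<Prod>\<^sub># ?M \<le> n" using assms(1) by (simp add: dvd_imp_le)
  then show ?thesis
    using power_size_le_prod_mset[of z ?M] assms(2) by (smt (verit) mem_Collect_eq of_nat_mono set_mset_filter)
qed

lemma bigomega_split:
  assumes "n > 0" "\<not> 4 dvd n"
  shows "bigomega n \<le> 1 + size (filter_mset (\<lambda>p. p \<noteq> 2 \<and> real p \<le> z) (prime_factorization n))
     + size (filter_mset (\<lambda>p. z < real p \<and> p \<noteq> 2) (prime_factorization n))"
proof -
  let ?M = "prime_factorization n"
  have "multiplicity 2 n < 2"
    using assms by (intro multiplicity_lessI) auto
  then have c: "count ?M 2 \<le> 1" by (simp add: count_prime_factorization_prime)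
  have "?M = filter_mset (\<lambda>p. p = 2) ?M + filter_mset (\<lambda>p. p \<noteq> 2 \<and> real p \<le> z) ?M
      + filter_mset (\<lambda>p. z < real p \<and> p \<noteq> 2) ?M"
    by (rule multiset_eqI) auto
  then have "size ?M = size (filter_mset (\<lambda>p. p = 2) ?M) + size (filter_mset (\<lambda>p. p \<noteq> 2 \<and> real p \<le> z) ?M)
      + size (filter_mset (\<lambda>p. z < real p \<and> p \<noteq> 2) ?M)"
    by (metis size_union)
  moreover have "size (filter_mset (\<lambda>p. p = 2) ?M) = count ?M 2"
    by (simp add: filter_eq_replicate_mset)
  ultimately show ?thesis using c by (simp add: bigomega_def)
qed

section \<open>Congruence conditions on a\<close>

text \<open>For even N both factors are odd; for odd N only a is even, and it is 2 modulo 4.\<close>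

lemma not_4_dvd_mult:
  fixes N a :: nat
  assumes "a < N" "a mod 4 = (if even N then 1 else 2)"
  shows "\<not> 4 dvd a * (N - a)"
proof (cases "even N")
  case True
  then have "a mod 4 = 1" using assms by simp
  then have "odd a" by presburger
  then have "odd (a * (N - a))" using True assms(1) by simp
  moreover have "2 dvd (4::nat)" by simp
  ultimately show ?thesis using dvd_trans by blast
next
  case False
  then have a: "a mod 4 = 2" using assms by simp
  then have "even a" by presburger
  then have "odd (N - a)" using False assms(1) by simp
  then obtain i where i: "N - a = 2 * i + 1" by (elim oddE)
  have "a = 4 * (a div 4) + 2" using a by presburger
  then obtain j where "a = 4 * j + 2" by blast
  then have "a * (N - a) = 4 * (2 * i * j + j + i) + 2" unfolding i by (simp add: algebra_simps)
  then show ?thesis by presburger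
qed

lemma dvd_diff_iff_cong:
  fixes a N p :: nat
  assumes "a \<le> N"
  shows "p dvd N - a \<longleftrightarrow> [a = N] (mod p)"
  using assms by (metis cong_altdef_nat cong_sym_eq)

text \<open>Q is invertible modulo p. The two targets c = 0 and c = N then account for at most two
  forbidden residues.\<close>

lemma card_linear_cong_le_1:
  fixes p Q :: nat
  assumes "coprime Q p"
  shows "card {r. r < p \<and> [a + Q * r = c] (mod p)} \<le> 1"
proof -
  have "r = s" if "r < p" "s < p" "[a + Q * r = c] (mod p)" "[a + Q * s = c] (mod p)" for r s
  proof -
    have "[a + Q * r = a + Q * s] (mod p)" using that by (metis cong_sym cong_trans)
    then have "[r = s] (mod p)"
      using assms by (simp add: cong_add_lcancel_nat cong_mult_lcancel_nat)
    then show ?thesis using that by (simp add: cong_less_modulus_unique_nat)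
  qed
  moreover have "finite {r. r < p \<and> [a + Q * r = c] (mod p)}" by simp
  ultimately show ?thesis unfolding One_nat_def by (subst card_le_Suc0_iff_eq) auto
qed

lemma coprime_4_odd: "odd n \<Longrightarrow> coprime 4 n" for n :: nat
proof -
  assume "odd n"
  then have "coprime (2 ^ 2) n" by (subst coprime_power_left_iff) (simp add: coprime_left_2_iff_odd)
  then show ?thesis by simp
qed

lemma sifted_residue_exists:
  fixes N :: nat
  assumes "finite S" "\<And>p. p \<in> S \<Longrightarrow> prime p \<and> 2 < p"
  shows "\<exists>a < 4 * \<Prod>S. a mod 4 = (if even N then 1 else 2) \<and>
     (\<forall>p\<in>S. \<not> [a = 0] (mod p) \<and> \<not> [a = N] (mod p))"
proof -
  let ?A = "insert 4 S"
  \<comment> \<open>Modulo an odd prime 1 and 2 are distinct and nonzero, so one of them also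
    differs from N.\<close>
  define u where "u p = (if p = 4 then if even N then 1 else 2 else if [N = 1] (mod p) then 2 else 1::nat)" for p
  have odd: "odd p" if "p \<in> S" for p using assms(2)[OF that] prime_odd_nat by auto
  have notin: "4 \<notin> S" using odd by force
  have c4: "coprime 4 p" if "p \<in> S" for p using odd[OF that] by (rule coprime_4_odd)
  have cop: "\<forall>i\<in>?A. \<forall>j\<in>?A. i \<noteq> j \<longrightarrow> coprime i j"
    using c4 assms(2) by (auto intro: primes_coprime simp: coprime_commute)
  have "\<forall>i\<in>?A. i \<noteq> 0" using assms(2) by force
  from chinese_remainder_unique_nat[OF _ this cop, of u] assms(1)
  obtain a where a: "a < \<Prod>?A" "\<forall>i\<in>?A. [a = u i] (mod i)" by auto
  have "a mod 4 = (if even N then 1 else 2)" using a(2) by (auto simp: u_def cong_def)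
  moreover have "\<not> [a = 0] (mod p) \<and> \<not> [a = N] (mod p)" if p: "p \<in> S" for p
  proof -
    have ap: "[a = u p] (mod p)" and p2: "2 < p" and p4: "p \<noteq> 4" using a p assms(2) notin by auto
    have not0: "\<not> [u p = 0] (mod p)" using p2 p4 by (auto simp: u_def cong_def)
    have notN: "\<not> [u p = N] (mod p)"
    proof (cases "[N = 1] (mod p)")
      case True
      then show ?thesis using p2 p4 by (auto simp: u_def cong_def)
    next
      case False
      then show ?thesis using p4 by (auto simp: u_def cong_sym_eq)
    qed
    show ?thesis using not0 notN ap by (metis cong_sym cong_trans)
  qed
  moreover have "\<Prod>?A = 4 * \<Prod>S" using assms(1) notin by simp
  ultimately show ?thesis using a(1) by auto
qed

section \<open>Large N: presieving followed by the sieve\<close>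

lemma large_case:
  fixes N :: nat
  assumes "N > 0" and lnN: "ln (real N) \<ge> 22400"
  shows "\<exists>a b :: nat. a > 0 \<and> b > 0 \<and> N = a + b \<and> bigomega (a * b) \<le> 33"
proof -
  define t where "t = ln (real N) / 16"
  have t: "t \<ge> 1400" using lnN by (simp add: t_def)
  have N_exp: "real N = exp (16 * t)" using assms(1) by (simp add: t_def)
  define S where "S = {p. prime p \<and> real p \<le> t / 3 \<and> 2 < p}"
  have S: "finite S" "\<And>p. p \<in> S \<Longrightarrow> prime p \<and> 2 < p"
    unfolding S_def by (rule finite_primes_real) auto
  define Q where "Q = 4 * \<Prod>S"
  have "Q > 0" using S(2) unfolding Q_def by (intro mult_pos_pos prod_pos) force+
  from sifted_residue_exists[OF S, of N] obtain a0 where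
    a0: "a0 < Q" "a0 mod 4 = (if even N then 1 else 2)"
      "\<And>p. p \<in> S \<Longrightarrow> \<not> [a0 = 0] (mod p) \<and> \<not> [a0 = N] (mod p)"
    unfolding Q_def by blast

  \<comment> \<open>Q is twice the primorial of t/3, hence at most 2 * 4^(t/3). As (log 4)/3 <=
    25/54 < 1/2, there is room for the factor 2; this is why presieving stops at t/3.\<close>
  have Q_le: "real Q \<le> exp (t / 2)"
  proof -
    define n where "n = nat \<lfloor>t / 3\<rfloor>"
    have n: "real n \<le> t / 3" unfolding n_def using t by (intro of_nat_floor) simp
    have "2 \<notin> S" by (simp add: S_def)
    have "2 \<le> \<lfloor>t / 3\<rfloor>" using t by (simp add: le_floor_iff)
    have "2 * \<Prod>S = \<Prod>(insert 2 S)" using S \<open>2 \<notin> S\<close> by simp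
    also have "insert 2 S = {p. prime p \<and> p \<le> n}"
      using t \<open>2 \<le> \<lfloor>t / 3\<rfloor>\<close> unfolding S_def n_def
      by (auto simp: le_nat_iff le_floor_iff dest: prime_ge_2_nat order.not_eq_order_implies_strict)
    also have "\<Prod>\<dots> \<le> 4 ^ n" by (rule primorial_le)
    finally have "Q \<le> 2 * 4 ^ n" by (simp add: Q_def)
    then have "real Q \<le> real (2 * 4 ^ n)" by (rule of_nat_mono)
    also have "\<dots> = exp (ln 2 + real n * ln 4)"
      by (simp add: exp_add exp_of_nat_mult)
    also have "\<dots> \<le> exp (t / 2)"
    proof -
      have "ln (4::real) = 2 * ln 2" using ln_realpow[of 2 2] by simp
      then have "ln (4::real) \<le> 25/18" using ln2_le_25_over_36 by simp
      then have "real n * ln 4 \<le> t / 3 * (25/18)" using n t by (intro mult_mono) auto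
      then show ?thesis using ln2_le_25_over_36 t by simp
    qed
    finally show ?thesis .
  qed
  define X where "X = N div Q"
  have X: "exp (15 * t) \<le> real X"
  proof -
    have "real N / real Q - 1 \<le> real X"
      unfolding X_def using \<open>Q > 0\<close> floor_divide_of_nat_eq[of N Q, where 'a = real] by linarith
    moreover have "exp (16 * t) / exp (t / 2) \<le> real N / real Q"
      unfolding N_exp[symmetric] using Q_le \<open>Q > 0\<close> by (intro divide_left_mono) auto
    moreover have "exp (16 * t) / exp (t / 2) = exp (15 * t) * exp (t / 2)"
      by (simp add: exp_diff[symmetric] exp_add[symmetric])
    \<comment> \<open>The spare half unit absorbs the rounding in N div Q.\<close>
    moreover have "exp (t / 2) \<ge> 2" using exp_ge_add_one_self[of "t / 2"] t by linarith
    then have "exp (15 * t) * exp (t / 2) \<ge> exp (15 * t) * 2" by (intro mult_left_mono) auto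
    moreover have "exp (15 * t) \<ge> 1" using t by simp
    ultimately show ?thesis by linarith
  qed
  have coQ: "coprime Q p" if "prime p" "t / 3 < real p" for p
  proof -
    have "4 < real p" using that t by linarith
    then have "p > 4" by simp
    have "odd p" using prime_odd_nat[of p] \<open>p > 4\<close> that(1) by simp
    then have "coprime 4 p" by (rule coprime_4_odd)
    moreover have "coprime (\<Prod>S) p"
    proof (rule prod_coprime_left)
      fix q assume "q \<in> S"
      then have "prime q" "q \<noteq> p" using that(2) by (auto simp: S_def)
      then show "coprime q p" using that(1) by (simp add: primes_coprime)
    qed
    ultimately show ?thesis by (simp add: Q_def)
  qed
  \<comment> \<open>The residues of k modulo p for which p divides a or N - a, where a = a0 + Q
    k.\<close>
  define R where "R p = {r. r < p \<and> [a0 + Q * r = 0] (mod p)} \<union> {r. r < p \<and> [a0 + Q * r = N] (mod p)}" for p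
  have "\<exists>k<X. \<forall>p. prime p \<longrightarrow> t / 3 < real p \<longrightarrow> real p \<le> exp t \<longrightarrow> k mod p \<notin> R p"
  proof (rule large_sieve_nonempty[OF t _ X])
    fix p :: nat assume p: "prime p" "t / 3 < real p"
    have "card (R p) \<le> card {r. r < p \<and> [a0 + Q * r = 0] (mod p)} + card {r. r < p \<and> [a0 + Q * r = N] (mod p)}"
      unfolding R_def by (rule card_Un_le)
    also have "\<dots> \<le> 1 + 1" by (intro add_mono card_linear_cong_le_1 coQ p)
    finally show "R p \<subseteq> {..<p} \<and> card (R p) \<le> 2" by (auto simp: R_def)
  qed
  then obtain k where k: "k < X" "\<And>p. prime p \<Longrightarrow> t / 3 < real p \<Longrightarrow> real p \<le> exp t \<Longrightarrow> k mod p \<notin> R p"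
    by blast
  define a where "a = a0 + Q * k"
  have "Q * Suc k \<le> N"
  proof -
    have "Q * Suc k \<le> Q * X" using k by (intro mult_left_mono) auto
    also have "\<dots> \<le> N" by (simp add: X_def)
    finally show ?thesis .
  qed
  then have aN: "a < N" using a0(1) by (simp add: a_def)
  have a4: "a mod 4 = (if even N then 1 else 2)"
    unfolding a0(2)[symmetric] by (simp add: a_def Q_def mult.assoc)
  then have "a > 0" by (intro Nat.gr0I) (simp split: if_splits)
  \<comment> \<open>Odd primes up to t/3 are excluded by the choice of a0, those from t/3 to exp t
    by the sieve.\<close>
  have big: "exp t < real p" if p: "prime p" "p dvd a * (N - a)" "p \<noteq> 2" for p
  proof (rule ccontr)
    assume le: "\<not> exp t < real p"
    have p2: "p > 2" using p prime_ge_2_nat[of p] by linarith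
    have "p dvd a \<or> p dvd N - a" using p prime_dvd_mult_iff by blast
    then have ap: "[a = 0] (mod p) \<or> [a = N] (mod p)"
      using aN by (simp add: cong_0_iff dvd_diff_iff_cong)
    show False
    proof (cases "real p \<le> t / 3")
      case True
      then have "p \<in> S" using p p2 by (simp add: S_def)
      then have "p dvd Q" using S unfolding Q_def by (intro dvd_mult dvd_prodI) auto
      then have "[a = a0] (mod p)" unfolding a_def by (simp add: cong_def mod_add_right_eq[symmetric])
      then show False using ap a0(3)[OF \<open>p \<in> S\<close>] by (metis cong_sym cong_trans)
    next
      case False
      have "[a0 + Q * (k mod p) = a] (mod p)"
        unfolding a_def by (intro cong_add cong_mult cong_refl) (simp add: cong_def)
      then have "k mod p \<in> R p"
        using ap p2 by (auto simp: R_def intro: cong_trans)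
      then show False using k(2)[OF p(1)] False le by simp
    qed
  qed
  let ?ab = "a * (N - a)"
  have pos: "?ab > 0" using aN \<open>a > 0\<close> by simp
  have "filter_mset (\<lambda>p. p \<noteq> 2 \<and> real p \<le> exp t) (prime_factorization ?ab)
      = filter_mset (\<lambda>_. False) (prime_factorization ?ab)" (is "?M = _")
    using big by (intro filter_mset_cong) (auto simp: in_prime_factors_iff not_le)
  then have "size ?M = 0" by (simp only: filter_mset_False size_empty)
  then have "bigomega ?ab \<le> 1 + size (filter_mset (\<lambda>p. exp t < real p \<and> p \<noteq> 2) (prime_factorization ?ab))"
    using bigomega_split[OF pos not_4_dvd_mult[OF aN a4], of "exp t"] by linarith
  \<comment> \<open>Thirty-two factors above exp t would multiply to at least exp(32 t) = N^2, more
    than a (N - a).\<close>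
  moreover have "size (filter_mset (\<lambda>p. exp t < real p \<and> p \<noteq> 2) (prime_factorization ?ab)) < 32" (is "?s < 32")
  proof (rule ccontr)
    assume "\<not> ?s < 32"
    then have "exp t ^ 32 \<le> exp t ^ ?s" using t by (intro power_increasing) auto
    also have "\<dots> \<le> real ?ab" using pos by (intro power_size_large_factors_le) auto
    also have "\<dots> < real (N * N)"
      using aN \<open>a > 0\<close> by (intro of_nat_less_iff[THEN iffD2] mult_strict_mono) auto
    also have "\<dots> = exp (16 * t) * exp (16 * t)" by (simp add: N_exp)
    also have "\<dots> = exp t ^ 32" by (simp add: exp_add[symmetric] exp_of_nat_mult[symmetric])
    finally show False by simp
  qed
  ultimately show ?thesis
    using aN \<open>a > 0\<close> by (intro exI[of _ a] exI[of _ "N - a"]) auto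
qed

section \<open>Middle range: the mean number of prime factors\<close>

text \<open>Each squaring of the upper end adds 29/35 and an error inversely proportional to log w.
  The logarithm doubles each time, so the errors form a geometric series; 11/2 is a lower bound for
  log 256.\<close>

lemma sum_inverse_primes_tower:
  "(\<Sum>p | prime p \<and> 256 < real p \<and> real p \<le> 256 ^ (2 ^ k). 1 / real p)
     \<le> 29/35 * real k + 246/35 / (11/2) * (2 - 2 / 2 ^ k)"
proof (induction k)
  case 0
  have "{p::nat. prime p \<and> 256 < real p \<and> real p \<le> 256 ^ (2 ^ 0)} = {}" by auto
  then show ?case by (simp only:) simp
next
  case (Suc k)
  let ?w = "256 ^ (2 ^ k) :: real"
  have w1: "?w > 1" by (simp add: one_less_power)
  have sq: "256 ^ (2 ^ Suc k) = ?w\<^sup>2" by (simp add: power_mult[symmetric] mult.commute)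
  have "ln (256::real) = 8 * ln 2" using ln_realpow[of 2 8] by simp
  then have "ln ?w \<ge> 2 ^ k * (11/2)"
    using ln_2_ge by (simp add: ln_realpow)
  then have "246/35 / ln ?w \<le> 246/35 / (2 ^ k * (11/2))"
    by (intro divide_left_mono) auto
  then have block: "(\<Sum>p | prime p \<and> ?w < real p \<and> real p \<le> ?w\<^sup>2. 1 / real p)
      \<le> 29/35 + 246/35 / (2 ^ k * (11/2))"
    using sum_inverse_prime_square_block[OF w1 order_refl] by linarith
  have "(\<Sum>p | prime p \<and> 256 < real p \<and> real p \<le> ?w\<^sup>2. 1 / real p)
     \<le> (\<Sum>p\<in>{p. prime p \<and> 256 < real p \<and> real p \<le> ?w} \<union> {p. prime p \<and> ?w < real p \<and> real p \<le> ?w\<^sup>2}. 1 / real p)"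
    by (intro sum_mono2) auto
  also have "\<dots> \<le> (\<Sum>p | prime p \<and> 256 < real p \<and> real p \<le> ?w. 1 / real p)
      + (\<Sum>p | prime p \<and> ?w < real p \<and> real p \<le> ?w\<^sup>2. 1 / real p)"
    by (subst sum.union_disjoint) auto
  also have "\<dots> \<le> 29/35 * real k + 246/35 / (11/2) * (2 - 2 / 2 ^ k) + (29/35 + 246/35 / (2 ^ k * (11/2)))"
    by (intro add_mono Suc.IH block)
  also have "\<dots> = 29/35 * real (Suc k) + 246/35 / (11/2) * (2 - 2 / 2 ^ Suc k)"
    by (simp add: field_simps)
  finally show ?case unfolding sq .
qed

lemma harm_le: "n > 0 \<Longrightarrow> harm n \<le> 1 + ln (real n)"
  using decseqD[OF decseq_harm_diff_ln, of 0 "n - 1"] by (simp add: harm_expand)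

text \<open>For p = 2i+1 the summand is 1/(2i), so half the harmonic number of 127 is an upper
  bound.\<close>

lemma sum_small_odd_primes:
  "(\<Sum>p | prime p \<and> 2 < p \<and> real p \<le> 256. 1 / (real p - 1)) \<le> 3"
proof -
  have "nat \<lfloor>(256 - 1) / 2 :: real\<rfloor> = 127" by (simp add: floor_eq_iff)
  then have sub: "{p::nat. prime p \<and> 2 < p \<and> real p \<le> 256} \<subseteq> (\<lambda>i. 2 * i + 1) ` {1..127}"
    using odd_primes_subset[of 256] by simp
  have "(\<Sum>p | prime p \<and> 2 < p \<and> real p \<le> 256. 1 / (real p - 1))
      \<le> (\<Sum>p\<in>(\<lambda>i. 2 * i + 1) ` {1..127}. 1 / (real p - 1))"
    using sub by (intro sum_mono2) auto
  also have "\<dots> = (\<Sum>i=1..127. inverse (real i) / 2)"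
    by (subst sum.reindex) (auto simp: inj_on_def field_simps)
  also have "\<dots> = harm 127 / 2" unfolding harm_def by (simp add: sum_divide_distrib)
  also have "harm 127 \<le> 1 + ln (127::real)" using harm_le[of 127] by simp
  also have "ln (127::real) \<le> ln (2 ^ 7)" by (subst ln_le_cancel_iff) auto
  also have "\<dots> = 7 * ln 2" by (subst ln_realpow) auto
  also have "\<dots> \<le> 5" using ln2_le_25_over_36 by simp
  finally show ?thesis by simp
qed

lemma sum_odd_primes_le:
  assumes "s > 0" "ln s \<le> 11200"
  shows "(\<Sum>p | prime p \<and> 2 < p \<and> real p \<le> s. 1 / (real p - 1)) \<le> 15"
proof -
  \<comment> \<open>Eleven squarings suffice: log T >= 2^11 * 11/2 = 11264.\<close>
  define T :: real where "T = 256 ^ (2 ^ 11)"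
  have "T > 0" unfolding T_def by (rule zero_less_power) simp
  have "ln T = real (2 ^ 11) * ln 256" unfolding T_def by (rule ln_realpow)
  also have "ln (256::real) = 8 * ln 2" using ln_realpow[of 2 8] by simp
  finally have "ln s \<le> ln T" using assms(2) ln_2_ge by simp
  then have sT: "s \<le> T" using assms(1) \<open>T > 0\<close> by simp
  let ?A = "{p::nat. prime p \<and> 2 < p \<and> real p \<le> 256}"
  let ?B = "{p::nat. prime p \<and> 256 < real p \<and> real p \<le> T}"
  have "(\<Sum>p | prime p \<and> 2 < p \<and> real p \<le> s. 1 / (real p - 1)) \<le> (\<Sum>p\<in>?A \<union> ?B. 1 / (real p - 1))"
  proof (rule sum_mono2)
    show "{p::nat. prime p \<and> 2 < p \<and> real p \<le> s} \<subseteq> ?A \<union> ?B" using sT by auto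
  qed auto
  also have "\<dots> = (\<Sum>p\<in>?A. 1 / (real p - 1)) + (\<Sum>p\<in>?B. 1 / (real p - 1))"
    by (intro sum.union_disjoint) auto
  \<comment> \<open>For p >= 257 the quotient p/(p-1) is at most 257/256.\<close>
  also have "(\<Sum>p\<in>?B. 1 / (real p - 1)) \<le> (\<Sum>p\<in>?B. 257/256 * (1 / real p))"
    by (intro sum_mono) (auto simp: divide_simps)
  also have "\<dots> = 257/256 * (\<Sum>p\<in>?B. 1 / real p)" by (simp only: sum_distrib_left)
  also have "\<dots> \<le> 257/256 * (29/35 * real 11 + 246/35 / (11/2) * (2 - 2 / 2 ^ 11))"
    unfolding T_def by (intro mult_left_mono sum_inverse_primes_tower) simp
  also have "\<dots> \<le> 12" by simp
  finally show ?thesis using sum_small_odd_primes by simp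
qed

text \<open>Since m is invertible modulo q, all solutions lie in one residue class modulo q.\<close>

lemma card_dvd_progression_le:
  fixes m q X :: nat
  assumes "coprime m q" "q > 0"
  shows "real (card {k. k < X \<and> [c + m * k = d] (mod q)}) \<le> real X / real q + 1"
proof (cases "{k. k < X \<and> [c + m * k = d] (mod q)} = {}")
  case True
  then show ?thesis by (simp only:) simp
next
  case False
  then obtain k0 where k0: "[c + m * k0 = d] (mod q)" by blast
  have "{k. k < X \<and> [c + m * k = d] (mod q)} \<subseteq> {k. k < X \<and> k mod q = k0 mod q}"
  proof safe
    fix k assume "[c + m * k = d] (mod q)"
    then have "[c + m * k = c + m * k0] (mod q)" using k0 by (metis cong_sym cong_trans)
    then have "[k = k0] (mod q)" using assms(1) by (simp add: cong_add_lcancel_nat cong_mult_lcancel_nat)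
    then show "k mod q = k0 mod q" by (simp add: cong_def)
  qed
  then have "card {k. k < X \<and> [c + m * k = d] (mod q)} \<le> card {k. k < X \<and> k mod q = k0 mod q}"
    by (intro card_mono) auto
  then show ?thesis using card_residue_class[of "k0 mod q" q X] assms(2) by simp
qed

text \<open>A prime of multiplicity e in n contributes the e divisors p, ..., p^e. The common bound
  N makes the set of candidates independent of n, so that sums over n and over q can be
  exchanged.\<close>

lemma size_filter_prime_factorization:
  fixes n N :: nat
  assumes "0 < n" "n \<le> N"
  shows "size (filter_mset A (prime_factorization n))
    = card {q \<in> {q. primepow q \<and> q \<le> N \<and> A (aprimedivisor q)}. q dvd n}"
proof -
  have size_filter: "size (filter_mset A M) = (\<Sum>p\<in>#M. if A p then 1 else 0)" for M
    by (induction M) simp_all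
  have "size (filter_mset A (prime_factorization n)) = (\<Sum>p\<in>#prime_factorization n. if A p then 1 else 0)"
    by (rule size_filter)
  also have "\<dots> = (\<Sum>q\<in>primepow_factors n. if A (aprimedivisor q) then 1 else 0)"
    using assms(1) by (intro sum_prime_factorization_conv_sum_primepow_factors[symmetric]) simp
  also have "\<dots> = card {q \<in> primepow_factors n. A (aprimedivisor q)}"
    using assms(1) finite_primepow_factors[of n] by (simp add: sum.inter_filter[symmetric])
  also have "{q \<in> primepow_factors n. A (aprimedivisor q)}
     = {q \<in> {q. primepow q \<and> q \<le> N \<and> A (aprimedivisor q)}. q dvd n}"
    using assms by (auto simp: primepow_factors_def dest: dvd_imp_le)
  finally show ?thesis .
qed

text \<open>A prime power is given by its base, at most s, and its exponent, at most L because 2^i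
  <= p^i <= N.\<close>

lemma card_primepows_le:
  fixes s :: real
  assumes "s \<ge> 0" "N < 2 ^ Suc L"
  shows "real (card {q. primepow q \<and> q \<le> N \<and> aprimedivisor q \<noteq> 2 \<and> real (aprimedivisor q) \<le> s}) \<le> s * real L"
proof -
  let ?Q = "{q. primepow q \<and> q \<le> N \<and> aprimedivisor q \<noteq> 2 \<and> real (aprimedivisor q) \<le> s}"
  let ?f = "\<lambda>(p, i). p ^ i :: nat"
  let ?D = "{1..nat \<lfloor>s\<rfloor>} \<times> {1..L}"
  have "?Q \<subseteq> ?f ` ?D"
  proof
    fix q assume q: "q \<in> ?Q"
    then obtain p i where pi: "prime p" "i > 0" "q = p ^ i" by (auto simp: primepow_def)
    then have "aprimedivisor q = p" by (simp add: aprimedivisor_prime_power)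
    have "2 ^ i \<le> p ^ i" using pi prime_ge_2_nat by (intro power_mono) auto
    also have "\<dots> < 2 ^ Suc L" using q pi assms(2) by auto
    finally have "i < Suc L" by (simp only: power_strict_increasing_iff)
    then show "q \<in> ?f ` ?D"
      using pi q \<open>aprimedivisor q = p\<close> prime_ge_1_nat[of p]
      by (intro image_eqI[of _ _ "(p, i)"]) (auto simp: le_nat_floor)
  qed
  then have "card ?Q \<le> card (?f ` ?D)" by (intro card_mono) auto
  also have "\<dots> \<le> card ?D" by (intro card_image_le) auto
  finally have "card ?Q \<le> nat \<lfloor>s\<rfloor> * L" by simp
  from of_nat_mono[OF this, where 'a = real]
  have "real (card ?Q) \<le> real (nat \<lfloor>s\<rfloor>) * real L" by (simp only: of_nat_mult)
  also have "\<dots> \<le> s * real L" using assms(1) by (intro mult_right_mono of_nat_floor) auto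
  finally show ?thesis .
qed

lemma medium_case:
  fixes N :: nat
  assumes N: "2 ^ 33 \<le> N" and lnN: "ln (real N) \<le> 22400"
  shows "\<exists>a b :: nat. a > 0 \<and> b > 0 \<and> N = a + b \<and> bigomega (a * b) \<le> 33"
proof -
  define s where "s = sqrt (real N)"
  have N0: "N > 0" using N by (metis gr0I not_less zero_less_numeral zero_less_power)
  have s0: "s > 0" "s * s = real N" using N0 by (auto simp: s_def)
  have lns: "ln s \<le> 11200" using lnN N0 by (simp add: s_def ln_sqrt)
  define c :: nat where "c = (if even N then 1 else 2)"
  define X where "X = N div 4"
  define A where "A = (\<lambda>p::nat. p \<noteq> 2 \<and> real p \<le> s)"
  define Om where "Om n = size (filter_mset A (prime_factorization n))" for n
  define QQ where "QQ = {q. primepow q \<and> q \<le> N \<and> A (aprimedivisor q)}"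
  have finQ: "finite QQ" unfolding QQ_def by (rule finite_subset[of _ "{..N}"]) auto
  have aN: "c + 4 * k < N" "c + 4 * k > 0" if "k < X" for k
  proof -
    have "Suc k \<le> N div 4" using that by (simp add: X_def)
    then have "Suc k * 4 \<le> N" by (simp add: less_eq_div_iff_mult_less_eq)
    then show "c + 4 * k < N" by (simp add: c_def)
    show "c + 4 * k > 0" by (simp add: c_def)
  qed

  obtain L where L: "2 ^ L \<le> N" "N < 2 ^ Suc L"
    using ex_power_ivl1[of 2 N] N0 by auto
  have "33 \<le> L"
  proof -
    have "(2::nat) ^ 33 < 2 ^ Suc L" using N L by linarith
    then have "33 < Suc L" by (simp only: power_strict_increasing_iff)
    then show ?thesis by simp
  qed
  \<comment> \<open>Ensures that the rounding errors, one for each of the at most s L prime powers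
    and each of a and N - a, stay below X, which is about N/4.\<close>
  then have "(40 * (real L + 1))\<^sup>2 \<le> 2 ^ L"
  proof (induction L rule: nat_induct_at_least)
    case (Suc n)
    have "(40 * (real (Suc n) + 1))\<^sup>2 \<le> 2 * (40 * (real n + 1))\<^sup>2"
      using Suc(1) mult_mono[of 33 "real n" 33 "real n"] by (simp add: power2_eq_square algebra_simps)
    then show ?case using Suc by simp
  qed simp
  also have "\<dots> \<le> real N" using L(1) by (metis of_nat_le_iff of_nat_numeral of_nat_power)
  finally have sL: "40 * (real L + 1) \<le> s" unfolding s_def by (intro real_le_rsqrt)

  have card_QQ: "real (card QQ) \<le> s * real L"
    unfolding QQ_def A_def using s0 L by (intro card_primepows_le) auto
  have X_ge: "real N / 4 - 1 \<le> real X"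
    unfolding X_def using floor_divide_of_nat_eq[of N 4, where 'a = real] by simp
  have cardX: "2 * real (card QQ) < real X"
  proof -
    have "s * (40 * (real L + 1)) \<le> s * s" using sL s0 by (intro mult_left_mono) auto
    moreover have "s \<ge> 40" using sL by simp
    ultimately show ?thesis using card_QQ X_ge s0 by (simp add: algebra_simps)
  qed
  have sum_QQ: "(\<Sum>q\<in>QQ. 1 / real q) \<le> 15"
  proof -
    have "(\<Sum>q\<in>QQ. 1 / real q) \<le> (\<Sum>p | prime p \<and> p \<le> N \<and> A p. 1 / (real p - 1))"
      unfolding QQ_def using sum_primepow_le[of "\<lambda>_. 1" N A] by simp
    also have "\<dots> \<le> (\<Sum>p | prime p \<and> 2 < p \<and> real p \<le> s. 1 / (real p - 1))"
    proof (rule sum_mono2)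
      show "{p. prime p \<and> p \<le> N \<and> A p} \<subseteq> {p. prime p \<and> 2 < p \<and> real p \<le> s}"
        by (auto simp: A_def dest: prime_ge_2_nat order.not_eq_order_implies_strict)
    qed (auto dest: prime_ge_1_nat)
    also have "\<dots> \<le> 15" using s0 lns by (intro sum_odd_primes_le) auto
    finally show ?thesis .
  qed

  have co4: "coprime 4 q" "q > 0" if "q \<in> QQ" for q
  proof -
    from that obtain p i where pi: "prime p" "i > 0" "q = p ^ i" "A (aprimedivisor q)"
      by (auto simp: QQ_def primepow_def)
    then have "p \<noteq> 2" by (simp add: aprimedivisor_prime_power A_def)
    then have "odd q" using pi prime_odd_nat[of p] prime_ge_2_nat[of p] by auto
    then show "coprime 4 q" by (rule coprime_4_odd)
    show "q > 0" using \<open>odd q\<close> by (rule odd_pos)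
  qed
  have count: "(\<Sum>k<X. card {q\<in>QQ. [c + 4 * k = d] (mod q)}) \<le> real X * 15 + real (card QQ)" for d
  proof -
    have "(\<Sum>k<X. card {q\<in>QQ. [c + 4 * k = d] (mod q)}) = (\<Sum>k\<in>{..<X}. \<Sum>q\<in>{q\<in>QQ. [c + 4 * k = d] (mod q)}. 1)"
      by simp
    also have "\<dots> = (\<Sum>q\<in>QQ. \<Sum>k\<in>{k\<in>{..<X}. [c + 4 * k = d] (mod q)}. 1)"
      using finQ by (intro sum.swap_restrict) auto
    also have "\<dots> = (\<Sum>q\<in>QQ. card {k. k < X \<and> [c + 4 * k = d] (mod q)})" by simp
    finally have "real (\<Sum>k<X. card {q\<in>QQ. [c + 4 * k = d] (mod q)})
       = (\<Sum>q\<in>QQ. real (card {k. k < X \<and> [c + 4 * k = d] (mod q)}))" by simp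
    also have "\<dots> \<le> (\<Sum>q\<in>QQ. real X / real q + 1)"
      using co4 by (intro sum_mono card_dvd_progression_le) auto
    also have "\<dots> = real X * (\<Sum>q\<in>QQ. 1 / real q) + real (card QQ)"
      by (simp add: sum.distrib sum_distrib_left)
    also have "\<dots> \<le> real X * 15 + real (card QQ)"
      using sum_QQ by (intro add_right_mono mult_left_mono) auto
    finally show ?thesis .
  qed
  \<comment> \<open>The two counts together average at most 30 + 2 * card QQ / X < 31, and they are
    integers.\<close>
  have "\<exists>k<X. Om (c + 4 * k) + Om (N - (c + 4 * k)) \<le> 30"
  proof (rule ccontr)
    assume neg: "\<not> ?thesis"
    have "31 \<le> card {q\<in>QQ. [c + 4 * k = 0] (mod q)} + card {q\<in>QQ. [c + 4 * k = N] (mod q)}" if k: "k < X" for k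
    proof -
      have "\<not> Om (c + 4 * k) + Om (N - (c + 4 * k)) \<le> 30" using neg k by blast
      then have "31 \<le> Om (c + 4 * k) + Om (N - (c + 4 * k))" by linarith
      also have "Om (c + 4 * k) = card {q\<in>QQ. [c + 4 * k = 0] (mod q)}"
        unfolding Om_def QQ_def using aN[OF k] by (subst size_filter_prime_factorization[of _ N]) (auto simp: cong_0_iff)
      also have "Om (N - (c + 4 * k)) = card {q\<in>QQ. [c + 4 * k = N] (mod q)}"
        unfolding Om_def QQ_def using aN[OF k]
        by (subst size_filter_prime_factorization[of _ N]) (auto simp: dvd_diff_iff_cong)
      finally show ?thesis .
    qed
    then have "(\<Sum>k<X. 31) \<le> (\<Sum>k<X. card {q\<in>QQ. [c + 4 * k = 0] (mod q)} + card {q\<in>QQ. [c + 4 * k = N] (mod q)})"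
      by (intro sum_mono) auto
    then have "real (31 * X) \<le> real (\<Sum>k<X. card {q\<in>QQ. [c + 4 * k = 0] (mod q)} + card {q\<in>QQ. [c + 4 * k = N] (mod q)})"
      by (intro of_nat_mono) simp
    also have "\<dots> = real (\<Sum>k<X. card {q\<in>QQ. [c + 4 * k = 0] (mod q)}) + real (\<Sum>k<X. card {q\<in>QQ. [c + 4 * k = N] (mod q)})"
      by (simp only: sum.distrib of_nat_add)
    also have "\<dots> \<le> (real X * 15 + real (card QQ)) + (real X * 15 + real (card QQ))"
      by (intro add_mono count)
    finally show False using cardX by simp
  qed
  then obtain k where k: "k < X" "Om (c + 4 * k) + Om (N - (c + 4 * k)) \<le> 30" by blast
  define a where "a = c + 4 * k"
  have a: "a < N" "a > 0" using aN[OF k(1)] by (auto simp: a_def)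
  have Om_a: "Om a + Om (N - a) \<le> 30" using k(2) by (simp add: a_def)
  have a4: "a mod 4 = (if even N then 1 else 2)" by (simp add: a_def c_def)
  \<comment> \<open>Two prime factors above sqrt N would already multiply to N or more.\<close>
  have large: "size (filter_mset (\<lambda>p. s < real p \<and> p \<noteq> 2) (prime_factorization n)) \<le> 1"
    if "0 < n" "n < N" for n
  proof (rule ccontr)
    assume "\<not> ?thesis"
    moreover have "s \<ge> 1" using sL by simp
    ultimately have "s ^ 2 \<le> s ^ size (filter_mset (\<lambda>p. s < real p \<and> p \<noteq> 2) (prime_factorization n))"
      by (intro power_increasing) auto
    also have "\<dots> \<le> real n" using that s0 by (intro power_size_large_factors_le) auto
    finally show False using that s0 by (simp add: power2_eq_square)
  qed
  have "prime_factorization (a * (N - a)) = prime_factorization a + prime_factorization (N - a)"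
    using a by (intro prime_factorization_mult) auto
  \<comment> \<open>One factor 2, at most 30 odd factors up to sqrt N, and one beyond sqrt N from
    each of a and N - a.\<close>
  then have "bigomega (a * (N - a)) \<le> 1 + (Om a + Om (N - a)) + (1 + 1)"
    using bigomega_split[of "a * (N - a)" s, OF _ not_4_dvd_mult[OF a(1) a4]] a large[of a] large[of "N - a"]
    unfolding Om_def A_def by simp
  then show ?thesis using a Om_a by (intro exI[of _ a] exI[of _ "N - a"]) auto
qed

section \<open>Small N and the conclusion\<close>

lemma two_power_bigomega_le:
  assumes "n > 0"
  shows "2 ^ bigomega n \<le> n"
proof -
  have "(1::real) < real p" if "p \<in># prime_factorization n" for p
    using that prime_gt_1_nat by (auto simp: in_prime_factors_iff)
  then have "2 ^ size (prime_factorization n) \<le> real (\<Prod>\<^sub># (prime_factorization n))"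
    by (intro power_size_le_prod_mset) (auto simp: in_prime_factors_iff dest: prime_ge_2_nat)
  then show ?thesis using assms unfolding bigomega_def
    by (metis of_nat_le_iff of_nat_numeral of_nat_power prod_mset_prime_factorization_nat)
qed

lemma small_case:
  fixes N :: nat
  assumes "N \<ge> 2" "N < 2 ^ 33"
  shows "\<exists>a b :: nat. a > 0 \<and> b > 0 \<and> N = a + b \<and> bigomega (a * b) \<le> 33"
proof -
  have "(2::nat) ^ bigomega (N - 1) \<le> N - 1" using assms by (intro two_power_bigomega_le) simp
  also have "\<dots> < 2 ^ 33" using assms(2) by linarith
  finally have "bigomega (N - 1) < 33" by (simp only: power_strict_increasing_iff)
  then show ?thesis using assms by (intro exI[of _ 1] exI[of _ "N - 1"]) auto
qed

theorem theorem1p2: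
  fixes N :: nat
  assumes "N \<ge> 2"
  shows "\<exists>a b :: nat. a > 0 \<and> b > 0 \<and> N = a + b \<and> bigomega (a * b) \<le> 33"
proof -
  consider "N < 2 ^ 33" | "2 ^ 33 \<le> N" "ln (real N) \<le> 22400" | "ln (real N) \<ge> 22400"
    by linarith
  then show ?thesis
    using assms small_case medium_case large_case[of N] by cases auto
qed

end
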